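(* Let $A_1,A_2,\widehat C\in\mathbf{S}_+(n)$, let $A_1^{-1/2}A_2A_1^{-1/2}=U\Lambda U^\top$ be an orthogonal eigendecomposition ($U$ orthogonal, $\Lambda$ diagonal), and let $Z=U^\top A_1^{-1/2}\widehat C A_1^{-1/2}U$. If $t^*$ is a minimizer of $t\mapsto d\big(\varphi_{A_1\to A_2}(t),\widehat C\big)$ over $t\in\mathbb{R}$, then $$\operatorname{tr}\big(\log_m(Z\Lambda^{-t^*})\,\log_m(\Lambda)\big)=0 .$$ Moreover, this equation is equivalent to the orthogonality condition $$g_{R(t^* )}\Big(\log_{R(t^* )}\big(A_1^{-1/2}\widehat C A_1^{-1/2}\big),\ \log_{R(t^* )}\big(R(1+t^* )\big)\Big)=0,$$ where $R(t)=\big(A_1^{-1/2}A_2A_1^{-1/2}\big)^t=A_1^{-1/2}\varphi_{A_1\to A_2}(t)A_1^{-1/2}$.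
   Context: $\mathbf{S}_+(n)$ is the manifold of real symmetric positive-definite $n\times n$ matrices. $\log_m$ is the principal matrix logarithm (also applied to matrices, such as $Z\Lambda^{-t}$, that are diagonalizable with positive eigenvalues), and square roots are symmetric positive-definite. Natural metric at $A\in\mathbf{S}_+(n)$: $g_A(X,Y)=\operatorname{tr}(XA^{-1}YA^{-1})$ for symmetric $X,Y$. Logarithm map: $\log_A(B)=A^{1/2}\log_m(A^{-1/2}BA^{-1/2})A^{1/2}$ for $B\in\mathbf{S}_+(n)$. Natural distance: $d(A,B)=\|\log_m(A^{-1/2}BA^{-1/2})\|_F$. Geodesic: $\varphi_{A_1\to A_2}(t)=A_1^{1/2}(A_1^{-1/2}A_2A_1^{-1/2})^{t}A_1^{1/2}$, $t\in\mathbb{R}$. *)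

theory Defs
  imports "HOL-Analysis.Analysis"
begin

definition spd :: "real^'n^'n \<Rightarrow> bool" where
  "spd A \<longleftrightarrow> transpose A = A \<and> (\<forall>x. x \<noteq> 0 \<longrightarrow> x \<bullet> (A *v x) > 0)"

definition mat_pow :: "real^'n^'n \<Rightarrow> nat \<Rightarrow> real^'n^'n" where
  "mat_pow A k = (((**) A) ^^ k) (mat 1)"

definition mexp :: "real^'n^'n \<Rightarrow> real^'n^'n" where
  "mexp A = (\<Sum>k. (1 / fact k) *\<^sub>R mat_pow A k)"

definition complex_eigenvalue :: "real^'n^'n \<Rightarrow> complex \<Rightarrow> bool" where
  "complex_eigenvalue A z \<longleftrightarrow> (\<exists>v. v \<noteq> 0 \<and> map_matrix complex_of_real A *v v = z *s v)"

text \<open>The principal logarithm is the logarithm whose spectrum lies in the strip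
  \<open>\<bar>Im z\<bar> < pi\<close>. A real matrix without eigenvalues in \<open>(-\<infinity>, 0]\<close>, symmetric or not, has exactly
  one such logarithm, and that logarithm is real; hence quantifying over real matrices is enough.\<close>

definition mlog :: "real^'n^'n \<Rightarrow> real^'n^'n" where
  "mlog A = (THE X. mexp X = A \<and> (\<forall>z. complex_eigenvalue X z \<longrightarrow> \<bar>Im z\<bar> < pi))"

definition mpowr :: "real^'n^'n \<Rightarrow> real \<Rightarrow> real^'n^'n" where
  "mpowr A t = mexp (t *\<^sub>R mlog A)"

definition msqrt :: "real^'n^'n \<Rightarrow> real^'n^'n" where
  "msqrt A = (THE B. spd B \<and> B ** B = A)"

definition minvsqrt :: "real^'n^'n \<Rightarrow> real^'n^'n" where
  "minvsqrt A = matrix_inv (msqrt A)"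

definition spd_metric :: "real^'n^'n \<Rightarrow> real^'n^'n \<Rightarrow> real^'n^'n \<Rightarrow> real" where
  "spd_metric A X Y = trace (X ** matrix_inv A ** Y ** matrix_inv A)"

definition spd_log :: "real^'n^'n \<Rightarrow> real^'n^'n \<Rightarrow> real^'n^'n" where
  "spd_log A B = msqrt A ** mlog (minvsqrt A ** B ** minvsqrt A) ** msqrt A"

text \<open>The library norm on \<^typ>\<open>real^'n^'n\<close> is the Frobenius norm, not the operator norm.\<close>

definition spd_dist :: "real^'n^'n \<Rightarrow> real^'n^'n \<Rightarrow> real" where
  "spd_dist A B = norm (mlog (minvsqrt A ** B ** minvsqrt A))"

definition spd_geodesic :: "real^'n^'n \<Rightarrow> real^'n^'n \<Rightarrow> real \<Rightarrow> real^'n^'n" where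
  "spd_geodesic A1 A2 t = msqrt A1 ** mpowr (minvsqrt A1 ** A2 ** minvsqrt A1) t ** msqrt A1"

end

theory Submission
  imports Defs "HOL-Computational_Algebra.Fundamental_Theorem_Algebra"
begin

text \<open>In the eigenbasis of \<open>A\<^sub>1\<^sup>-\<^sup>1\<^sup>/\<^sup>2 A\<^sub>2 A\<^sub>1\<^sup>-\<^sup>1\<^sup>/\<^sup>2\<close> the distance to minimize is the Frobenius norm of \<open>log W(t)\<close>
  with \<open>W(t) = \<Lambda>\<^sup>-\<^sup>t\<^sup>/\<^sup>2 Z \<Lambda>\<^sup>-\<^sup>t\<^sup>/\<^sup>2\<close>, which is similar to \<open>Z \<Lambda>\<^sup>-\<^sup>t\<close>; both the trace in the equation
  and the metric in the orthogonality condition equal \<open>tr (log W(t) log \<Lambda>)\<close>. To see that it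
  vanishes at a minimizer, the squared norm is bounded from above near \<open>t\<^sup>*\<close> by a differentiable
  function that touches it at \<open>t\<^sup>*\<close> and has derivative \<open>- 2 tr (log W(t\<^sup>*) log \<Lambda>)\<close> there.\<close>

section \<open>Matrix exponential and principal logarithm\<close>

text \<open>The product of \<open>Z\<close> with a power of Lambda is in general not symmetric, and
  \<open>mlog\<close> is a definite description over all real matrices. Evaluating it therefore
  means excluding every competing logarithm, symmetric or not; this is the purpose of
  \<open>principal_log_eigenvector\<close>, whose proof has to pass to complex vectors because a
  real matrix may lack real eigenvectors. Once a principal logarithm is known on eigenvectors, it is
  known on every matrix similar to a positive diagonal one. Putting half of the power on each side
  makes \<open>W s\<close> symmetric, so its squared log-norm is a sum of squared logarithms of
  eigenvalues. Differentiating that sum directly would require eigenvalues that vary smoothly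
  through multiplicities. The majorant avoids this: it involves only the eigenvectors at the
  minimizer, which stay fixed, and the entries of \<open>W s\<close>. A point of the geodesic has no
  convenient square root. In the distance its inverse square root is replaced by any
  \<open>F\<close> that carries the point to the identity by congruence, since the two choices
  differ by an orthogonal factor.\<close>

lemma norm_matrix_mult_le: "norm (A ** B) \<le> norm A * norm B" for A :: "real^'n^'m" and B :: "real^'k^'n"
proof -
  have row: "norm ((A ** B) $ i) \<le> norm (A $ i) * norm B" for i
  proof -
    have "(A ** B) $ i = (\<Sum>j\<in>UNIV. (A $ i $ j) *\<^sub>R B $ j)"
      by (simp add: vec_eq_iff matrix_matrix_mult_def)
    also have "norm \<dots> \<le> (\<Sum>j\<in>UNIV. \<bar>A $ i $ j\<bar> * \<bar>norm (B $ j)\<bar>)"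
      by (rule order_trans[OF norm_sum]) simp
    also have "\<dots> \<le> norm (A $ i) * norm B"
      unfolding norm_vec_def by (rule order_trans[OF L2_set_mult_ineq]) (simp add: L2_set_def)
    finally show ?thesis .
  qed
  have "norm (A ** B) \<le> L2_set (\<lambda>i. norm (A $ i) * norm B) UNIV"
    unfolding norm_vec_def[of "A ** B"] by (rule L2_set_mono) (auto simp: row)
  then show ?thesis
    by (simp add: norm_vec_def[of A] flip: L2_set_left_distrib)
qed

lemma mat_pow_0 [simp]: "mat_pow A 0 = mat 1"
  and mat_pow_Suc: "mat_pow A (Suc k) = A ** mat_pow A k"
  by (simp_all add: mat_pow_def)

text \<open>The Frobenius norm of the identity is the square root of the dimension, so the factor
  \<open>norm (mat 1)\<close> remains already at exponent 0.\<close>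

lemma norm_mat_pow_le: "norm (mat_pow A k) \<le> norm A ^ k * norm (mat 1 :: real^'n^'n)"
  for A :: "real^'n^'n"
proof (induction k)
  case (Suc k)
  have "norm (mat_pow A (Suc k)) \<le> norm A * norm (mat_pow A k)"
    by (simp add: mat_pow_Suc norm_matrix_mult_le)
  also have "\<dots> \<le> norm A * (norm A ^ k * norm (mat 1 :: real^'n^'n))"
    by (rule mult_left_mono[OF Suc]) simp
  finally show ?case by (simp add: mult.assoc)
qed simp

lemma mexp_sums: "(\<lambda>k. (1 / fact k) *\<^sub>R mat_pow A k) sums mexp A"
  for A :: "real^'n^'n"
proof -
  have "summable (\<lambda>k. (norm A ^ k /\<^sub>R fact k) * norm (mat 1 :: real^'n^'n))"
    by (intro summable_mult2 summable_exp_generic)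
  then have "summable (\<lambda>k. (1 / fact k) *\<^sub>R mat_pow A k)"
  proof (rule summable_comparison_test[rotated], intro exI allI impI)
    fix k
    show "norm ((1 / fact k) *\<^sub>R mat_pow A k) \<le> (norm A ^ k /\<^sub>R fact k) * norm (mat 1 :: real^'n^'n)"
      using norm_mat_pow_le[of A k] by (simp add: divide_simps)
  qed
  then show ?thesis
    unfolding mexp_def by (rule summable_sums)
qed

lemma matrix_mult_bounded_linear:
  "bounded_linear (\<lambda>X. A ** X)" "bounded_linear (\<lambda>X. X ** A)" for A :: "real^'n^'n"
  unfolding linear_conv_bounded_linear[symmetric]
  by (auto intro!: linearI simp: vec_eq_iff matrix_matrix_mult_def algebra_simps sum.distrib sum_distrib_left)

lemma mat_pow_commute: "A ** mat_pow A k = mat_pow A k ** A"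
  by (induction k) (simp_all add: mat_pow_Suc matrix_mul_assoc)

lemma mexp_commute: "A ** mexp A = mexp A ** A"
proof (rule sums_unique2)
  show "(\<lambda>k. A ** ((1 / fact k) *\<^sub>R mat_pow A k)) sums (A ** mexp A)"
    by (rule bounded_linear.sums[OF matrix_mult_bounded_linear(1) mexp_sums])
  have "(\<lambda>k. ((1 / fact k) *\<^sub>R mat_pow A k) ** A) sums (mexp A ** A)"
    by (rule bounded_linear.sums[OF matrix_mult_bounded_linear(2) mexp_sums])
  moreover have "A ** (c *\<^sub>R mat_pow A k) = (c *\<^sub>R mat_pow A k) ** A" for c k
    using bounded_linear.linear[OF matrix_mult_bounded_linear(1), of A, THEN linear_cmul]
      bounded_linear.linear[OF matrix_mult_bounded_linear(2), of A, THEN linear_cmul] mat_pow_commute[of A k]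
    by metis
  ultimately show "(\<lambda>k. A ** ((1 / fact k) *\<^sub>R mat_pow A k)) sums (mexp A ** A)"
    by simp
qed

section \<open>Complexification and the exponential on eigenvectors and Jordan chains\<close>

abbreviation cmat :: "real^'n^'m \<Rightarrow> complex^'n^'m" where
  "cmat \<equiv> map_matrix complex_of_real"

lemma cmat_mult: "cmat (A ** B) = cmat A ** cmat B"
  by (simp add: vec_eq_iff matrix_matrix_mult_def)

lemma cmat_mat_pow_mult_vec: "cmat (mat_pow X k) *v w = (((*v) (cmat X)) ^^ k) w"
proof (induction k)
  case 0
  have "cmat (mat 1) = (mat 1 :: complex^'a^'a)"
    by (simp add: vec_eq_iff mat_def)
  then show ?case by simp
next
  case (Suc k)
  then show ?case
    by (simp add: mat_pow_Suc cmat_mult flip: matrix_vector_mul_assoc)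
qed

lemma cmat_mexp_sums:
  "(\<lambda>k. ((((*v) (cmat X)) ^^ k) w) $ i / fact k) sums ((cmat (mexp X) *v w) $ i)"
  for X :: "real^'n^'n"
proof -
  have "bounded_linear (\<lambda>Y :: real^'n^'n. (cmat Y *v w) $ i)"
    unfolding linear_conv_bounded_linear[symmetric]
    by (auto intro!: linearI simp: matrix_vector_mult_def algebra_simps sum.distrib sum_distrib_left scaleR_conv_of_real[where 'a=complex])
  from bounded_linear.sums[OF this mexp_sums[of X]]
  have "(\<lambda>k. (cmat ((1 / fact k) *\<^sub>R mat_pow X k) *v w) $ i) sums ((cmat (mexp X) *v w) $ i)" .
  moreover have "(cmat ((1 / fact k) *\<^sub>R mat_pow X k) *v w) $ i = (cmat (mat_pow X k) *v w) $ i / fact k" for k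
    by (simp add: matrix_vector_mult_def sum_divide_distrib)
  ultimately show ?thesis
    by (simp add: cmat_mat_pow_mult_vec)
qed

text \<open>On the span of \<open>u\<close> and \<open>w\<close> the matrix acts as a Jordan block
  of size 2, and the exponential of that block is \<open>exp l\<close> times a unipotent block. The
  choice \<open>u = 0\<close> covers plain eigenvectors.\<close>

lemma cmat_mexp_jordan_chain:
  fixes X :: "real^'n^'n"
  assumes w: "cmat X *v w = l *s w + u" and u: "cmat X *v u = l *s u"
  shows "cmat (mexp X) *v w = exp l *s (w + u)"
proof -
  \<comment> \<open>At \<open>k = 0\<close> the truncated exponent \<open>k - 1\<close> is harmless
    because of the factor \<open>of_nat k\<close>.\<close>
  have pow: "(((*v) (cmat X)) ^^ k) w = l ^ k *s w + (of_nat k * l ^ (k - 1)) *s u" for k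
  proof (induction k)
    case (Suc k)
    have "(((*v) (cmat X)) ^^ Suc k) w = cmat X *v (l ^ k *s w + (of_nat k * l ^ (k - 1)) *s u)"
      by (simp only: funpow.simps o_apply Suc)
    also have "\<dots> = l ^ k *s (l *s w + u) + (of_nat k * l ^ (k - 1)) *s (l *s u)"
      by (simp only: matrix_vector_right_distrib vec.scale w u)
    also have "\<dots> = l ^ Suc k *s w + (of_nat (Suc k) * l ^ (Suc k - 1)) *s u"
      by (cases k) (simp_all add: vec_eq_iff algebra_simps)
    finally show ?case .
  qed simp
  have e1: "(\<lambda>k. l ^ k / fact k) sums exp l"
    using exp_converges[of l] by (simp add: scaleR_conv_of_real field_simps)
  \<comment> \<open>Cancelling k + 1 against the factorial turns the differentiated exponential
    series into the exponential series shifted by one place; its term at 0 vanishes.\<close>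
  have "(\<lambda>k. of_nat (Suc k) * l ^ (Suc k - 1) / fact (Suc k)) sums exp l"
    using e1 by (simp add: divide_simps del: of_nat_Suc)
  then have e2: "(\<lambda>k. of_nat k * l ^ (k - 1) / fact k) sums exp l"
    by (subst (asm) sums_Suc_iff) simp
  show ?thesis
  proof (subst vec_eq_iff, intro allI)
    fix i
    have "(\<lambda>k. l ^ k / fact k * w $ i + of_nat k * l ^ (k - 1) / fact k * u $ i)
        sums (exp l * w $ i + exp l * u $ i)"
      by (intro sums_add sums_mult2 e1 e2)
    then have "(\<lambda>k. ((((*v) (cmat X)) ^^ k) w) $ i / fact k) sums (exp l * w $ i + exp l * u $ i)"
      by (simp add: pow add_divide_distrib)
    with cmat_mexp_sums show "(cmat (mexp X) *v w) $ i = (exp l *s (w + u)) $ i"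
      by (auto simp: algebra_simps dest: sums_unique2)
  qed
qed

text \<open>This is p(M) v evaluated by Horner's rule. Keeping \<open>p\<close> as a polynomial
  gives access to its degree and roots, and the vectors obtained for varying \<open>p\<close> form
  the cyclic space of \<open>v\<close>.\<close>

definition poly_act :: "complex^'n^'n \<Rightarrow> complex poly \<Rightarrow> complex^'n \<Rightarrow> complex^'n" where
  "poly_act M p v = fold_coeffs (\<lambda>a w. a *s v + M *v w) p 0"

lemma poly_act_0 [simp]: "poly_act M 0 v = 0"
  by (simp add: poly_act_def)

lemma poly_act_pCons [simp]: "poly_act M (pCons a p) v = a *s v + M *v poly_act M p v"
  by (cases "p = 0 \<and> a = 0") (auto simp: poly_act_def)

lemma poly_act_add: "poly_act M (p + q) v = poly_act M p v + poly_act M q v"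
  by (induction p q rule: poly_induct2) (simp_all add: matrix_vector_right_distrib vec.scale_left_distrib)

lemma poly_act_smult: "poly_act M (smult c p) v = c *s poly_act M p v"
  by (induction p) (simp_all add: vec.scale vec.scale_right_distrib)

lemma poly_act_monom: "poly_act M (monom c k) v = c *s ((((*v) M) ^^ k) v)"
  by (induction k) (simp_all add: monom_0 monom_Suc vec.scale)

lemma poly_act_sum: "poly_act M (\<Sum>i\<in>I. f i) v = (\<Sum>i\<in>I. poly_act M (f i) v)"
  by (induction I rule: infinite_finite_induct) (simp_all add: poly_act_add)

lemma poly_act_commute:
  assumes "M ** N = N ** M"
  shows "poly_act M p (N *v v) = N *v poly_act M p v"
  using assms
  by (induction p) (simp_all add: matrix_vector_right_distrib vec.scale matrix_vector_mul_assoc)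

lemma poly_act_scale: "poly_act M p (c *s v) = c *s poly_act M p v"
  by (induction p) (simp_all add: vec.scale vec.scale_right_distrib mult.commute)

lemma poly_act_linear_factor:
  "poly_act M ([:- l, 1:] * q) v = M *v poly_act M q v - l *s poly_act M q v"
proof -
  have "[:- l, 1:] * q = pCons 0 q + smult (- l) q"
    by simp
  then show ?thesis
    unfolding poly_act_add by (simp add: poly_act_add poly_act_smult del: smult_minus_left)
qed

text \<open>The n + 1 iterates of \<open>v\<close> live in dimension n, and the coefficients of a
  linear relation between them are the coefficients of \<open>p\<close>.\<close>

lemma poly_act_annihilator:
  fixes M :: "complex^'n^'n"
  obtains p where "p \<noteq> 0" "poly_act M p v = 0"
proof -
  define f where "f i = (((*v) M) ^^ i) v" for i
  have "\<exists>p. p \<noteq> 0 \<and> poly_act M p v = 0"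
  \<comment> \<open>Linear dependence is a property of sets, so repeated iterates would be lost in
    the image. A repetition supplies the relation x^i - x^j directly.\<close>
  proof (cases "inj_on f {..CARD('n)}")
    case True
    have "vec.dependent (f ` {..CARD('n)})"
    proof (rule ccontr)
      assume "vec.independent (f ` {..CARD('n)})"
      then have "card (f ` {..CARD('n)}) \<le> vec.dim (UNIV :: (complex^'n) set)"
        by (intro vec.independent_card_le_dim) auto
      then show False
        using card_image[OF True] by (simp add: vec.dim_UNIV card_cart_basis)
    qed
    then obtain u where u: "\<exists>x\<in>f ` {..CARD('n)}. u x \<noteq> 0" "(\<Sum>x\<in>f ` {..CARD('n)}. u x *s x) = 0"
      by (subst (asm) vec.dependent_finite) auto
    define p where "p = (\<Sum>i\<le>CARD('n). monom (u (f i)) i)"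
    have "coeff p i = u (f i)" if "i \<le> CARD('n)" for i
      using that by (simp add: p_def coeff_sum)
    with u(1) have "p \<noteq> 0"
      by auto
    moreover have "poly_act M p v = 0"
      using u(2) unfolding sum.reindex[OF True]
      by (simp add: p_def poly_act_sum poly_act_monom f_def o_def)
    ultimately show ?thesis by blast
  next
    case False
    then obtain i j where ij: "i \<noteq> j" "f i = f j"
      by (auto simp: inj_on_def)
    define p :: "complex poly" where "p = monom 1 i + smult (- 1) (monom 1 j)"
    have "coeff p i = 1"
      using ij by (simp add: p_def)
    then have "p \<noteq> 0" by auto
    moreover have "poly_act M p v = 0"
      unfolding p_def poly_act_add poly_act_smult poly_act_monom
      using ij by (simp add: f_def)
    ultimately show ?thesis by blast
  qed
  then show ?thesis
    using that by blast
qed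

text \<open>Linear factors are split off an annihilating polynomial for as long as the quotient
  still kills \<open>v\<close>. A nonzero constant cannot do so, hence at some stage p = (x - l) q
  kills \<open>v\<close> while \<open>q\<close> does not, and q(M) v is an eigenvector. That it lies
  in the cyclic space of \<open>v\<close> is what the application needs.\<close>

lemma poly_act_eigenvector:
  fixes M :: "complex^'n^'n"
  assumes "v \<noteq> 0"
  obtains q l where "poly_act M q v \<noteq> 0" "M *v poly_act M q v = l *s poly_act M q v"
proof -
  obtain p where "p \<noteq> 0" "poly_act M p v = 0"
    using poly_act_annihilator .
  then have "\<exists>q l. poly_act M q v \<noteq> 0 \<and> M *v poly_act M q v = l *s poly_act M q v"
  proof (induction "degree p" arbitrary: p)
    case 0
    then obtain a where "p = [:a:]" "a \<noteq> 0"
      by (metis degree_eq_zeroE pCons_eq_0_iff)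
    with 0 assms show ?case
      by simp
  next
    case (Suc d)
    then have "\<not> constant (poly p)"
      by (simp add: constant_degree)
    then obtain l where "poly p l = 0"
      using fundamental_theorem_of_algebra by blast
    then obtain q where q: "p = [:- l, 1:] * q"
      by (metis dvdE poly_eq_0_iff_dvd)
    with Suc.prems have "q \<noteq> 0" by auto
    show ?case
    proof (cases "poly_act M q v = 0")
      case True
      have "degree p = Suc (degree q)"
        using \<open>q \<noteq> 0\<close> unfolding q by (subst degree_mult_eq) auto
      with Suc True \<open>q \<noteq> 0\<close> show ?thesis by auto
    next
      case False
      with Suc.prems show ?thesis
        unfolding q poly_act_linear_factor by auto
    qed
  qed
  with that show ?thesis by blast
qed

text \<open>If \<open>N = X - ln a\<close> did not kill \<open>v\<close>, the cyclic space of \<open>N v\<close> would contain an eigenvector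
  \<open>u = N w\<close> of \<open>X\<close>, with \<open>w\<close> in the cyclic space of \<open>v\<close>. Its eigenvalue is \<open>ln a\<close> by the strip
  condition, so \<open>a w = exp X w = a (w + u)\<close>, a contradiction.\<close>

lemma principal_log_eigenvector:
  fixes X :: "real^'n^'n"
  assumes strip: "\<forall>z. complex_eigenvalue X z \<longrightarrow> \<bar>Im z\<bar> < pi"
    and a: "a > 0" and v: "mexp X *v v = a *s v"
  shows "X *v v = ln a *s v"
proof -
  define M where "M = cmat X"
  define B where "B = cmat (mexp X)"
  define c where "c = complex_of_real (ln a)"
  define N where "N = M - mat c"
  define v' :: "complex^'n" where "v' = (\<chi> i. complex_of_real (v $ i))"
  have N: "N *v w = M *v w - c *s w" for w
  proof -
    have "mat c *v w = c *s w"
      by (simp add: vec_eq_iff mat_def matrix_vector_mult_def if_distrib[of "\<lambda>x. x * _"] cong: if_cong)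
    then show ?thesis
      by (simp add: N_def matrix_vector_mult_diff_rdistrib)
  qed
  have MB: "M ** B = B ** M"
    unfolding M_def B_def cmat_mult[symmetric] mexp_commute ..
  have MN: "M ** N = N ** M"
    unfolding matrix_eq by (auto simp: N vec.scale vec.diff algebra_simps simp flip: matrix_vector_mul_assoc)
  have emb: "cmat Y *v v' = (\<chi> i. complex_of_real ((Y *v v) $ i))" for Y :: "real^'n^'n"
    by (simp add: vec_eq_iff matrix_vector_mult_def v'_def)
  have Bv: "B *v v' = of_real a *s v'"
    unfolding B_def emb v by (simp add: vec_eq_iff v'_def)
  have "N *v v' = 0"
  proof (rule ccontr)
    assume "N *v v' \<noteq> 0"
    then obtain q l where u0: "poly_act M q (N *v v') \<noteq> 0"
      and ev: "M *v poly_act M q (N *v v') = l *s poly_act M q (N *v v')"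
      using poly_act_eigenvector by blast
    define w where "w = poly_act M q v'"
    define u where "u = N *v w"
    have u_eq: "poly_act M q (N *v v') = u"
      by (simp add: u_def w_def poly_act_commute[OF MN])
    have un: "u \<noteq> 0" and Mu: "M *v u = l *s u"
      using u0 ev by (simp_all add: u_eq)
    \<comment> \<open>The exponential commutes with \<open>X\<close>, so it acts as the scalar
      \<open>a\<close> on the whole cyclic space of \<open>v'\<close>, which contains both
      \<open>w\<close> and \<open>u\<close>.\<close>
    have Bw: "B *v w = of_real a *s w"
      by (simp add: w_def Bv poly_act_scale flip: poly_act_commute[OF MB])
    have Bu: "B *v u = of_real a *s u"
    proof -
      have "B ** M = M ** B" by (simp add: MB)
      then have "B *v (M *v w) = M *v (B *v w)"
        by (simp add: matrix_vector_mul_assoc)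
      then show ?thesis
        by (simp add: u_def N vec.diff vec.scale Bw vec.scale_right_diff_distrib mult.commute)
    qed
    have "cmat X *v u = l *s u + 0" "cmat X *v 0 = l *s 0"
      using Mu by (simp_all add: M_def)
    then have "B *v u = exp l *s u"
      unfolding B_def using cmat_mexp_jordan_chain[of X u l 0] by simp
    with Bu un have el: "exp l = of_real a"
      by simp
    have "complex_eigenvalue X l"
      unfolding complex_eigenvalue_def using un Mu by (auto simp: M_def)
    with strip have "\<bar>Im l\<bar> < pi" by blast
    then have "Ln (exp l) = l"
      by (intro Ln_exp) auto
    then have lc: "l = c"
      using a by (simp add: el c_def Ln_of_real)
    have "cmat X *v w = l *s w + u" "cmat X *v u = l *s u"
      using Mu by (simp_all add: u_def N lc M_def)
    then have "B *v w = of_real a *s (w + u)"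
      unfolding B_def el[symmetric] by (rule cmat_mexp_jordan_chain)
    then have "of_real a *s u = 0"
      by (simp add: Bw vec.scale_right_distrib)
    with a un show False by simp
  qed
  then have "cmat X *v v' = c *s v'"
    by (simp add: N M_def)
  then have "complex_of_real ((X *v v) $ i) = complex_of_real ((ln a *s v) $ i)" for i
    unfolding emb by (simp add: vec_eq_iff v'_def c_def)
  then have "(X *v v) $ i = (ln a *s v) $ i" for i
    by (simp only: of_real_eq_iff)
  then show ?thesis
    unfolding vec_eq_iff ..
qed

section \<open>Functions of matrices similar to a real diagonal matrix\<close>

definition mdiag :: "('n \<Rightarrow> real) \<Rightarrow> real^'n^'n" where
  "mdiag d = (\<chi> i j. if i = j then d i else 0)"

lemma mdiag_nth: "mdiag d $ i $ j = (if i = j then d i else 0)"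
  by (simp add: mdiag_def)

lemma matrix_mult_mdiag_nth: "(A ** mdiag d) $ i $ j = A $ i $ j * d j"
  by (simp add: matrix_matrix_mult_def mdiag_nth if_distrib cong: if_cong)

lemma mdiag_mult_matrix_nth: "(mdiag d ** A) $ i $ j = d i * A $ i $ j"
  by (simp add: matrix_matrix_mult_def mdiag_nth if_distrib[of "\<lambda>x. x * _"] cong: if_cong)

lemma mdiag_mult_mdiag: "mdiag a ** mdiag b = mdiag (\<lambda>i. a i * b i)"
  by (simp add: vec_eq_iff matrix_mult_mdiag_nth) (simp add: mdiag_nth)

lemma mdiag_one: "mdiag (\<lambda>_. 1) = mat 1"
  by (simp add: mdiag_def mat_def)

lemma transpose_mdiag [simp]: "transpose (mdiag d) = mdiag d"
  by (simp add: vec_eq_iff transpose_def mdiag_nth)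

lemma mdiag_mult_vec_nth: "(mdiag d *v x) $ i = d i * x $ i"
  by (simp add: matrix_vector_mult_def mdiag_nth if_distrib[of "\<lambda>x. x * _"] cong: if_cong)

lemma similar_mdiag_mult:
  fixes P Q :: "real^'n^'n"
  assumes "Q ** P = mat 1"
  shows "(P ** mdiag a ** Q) ** (P ** mdiag b ** Q) = P ** mdiag (\<lambda>i. a i * b i) ** Q"
proof -
  have "(P ** mdiag a ** Q) ** (P ** mdiag b ** Q) = P ** mdiag a ** (Q ** P) ** mdiag b ** Q"
    by (simp only: matrix_mul_assoc)
  also have "\<dots> = P ** (mdiag a ** mdiag b) ** Q"
    by (simp only: assms matrix_mul_rid matrix_mul_assoc)
  finally show ?thesis
    by (simp only: mdiag_mult_mdiag)
qed

lemma mat_pow_similar_mdiag: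
  fixes P Q :: "real^'n^'n"
  assumes "Q ** P = mat 1"
  shows "mat_pow (P ** mdiag d ** Q) k = P ** mdiag (\<lambda>i. d i ^ k) ** Q"
proof (induction k)
  case 0
  have "P ** Q = mat 1"
    using assms by (simp add: matrix_left_right_inverse)
  then show ?case
    by (simp add: mdiag_one)
next
  case (Suc k)
  then show ?case
    by (simp add: mat_pow_Suc similar_mdiag_mult[OF assms])
qed

lemma mexp_similar_mdiag:
  fixes P Q :: "real^'n^'n"
  assumes "Q ** P = mat 1"
  shows "mexp (P ** mdiag d ** Q) = P ** mdiag (\<lambda>i. exp (d i)) ** Q"
proof -
  have "(\<lambda>k. (1 / fact k) *\<^sub>R mdiag (\<lambda>i. d i ^ k)) sums mdiag (\<lambda>i. exp (d i))"
    unfolding sums_def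
  proof (intro vec_tendstoI)
    fix i j
    have "(\<lambda>k. d i ^ k /\<^sub>R fact k) sums exp (d i)"
      by (rule exp_converges)
    then show "(\<lambda>n. (\<Sum>k<n. (1 / fact k) *\<^sub>R mdiag (\<lambda>i. d i ^ k)) $ i $ j)
        \<longlonglongrightarrow> mdiag (\<lambda>i. exp (d i)) $ i $ j"
      by (cases "i = j") (simp_all add: mdiag_nth sums_def divide_simps)
  qed
  from bounded_linear.sums[OF bounded_linear_compose[OF matrix_mult_bounded_linear(2)[of Q]
      matrix_mult_bounded_linear(1)[of P]] this]
  have "(\<lambda>k. P ** ((1 / fact k) *\<^sub>R mdiag (\<lambda>i. d i ^ k)) ** Q) sums (P ** mdiag (\<lambda>i. exp (d i)) ** Q)" .
  moreover have "P ** (c *\<^sub>R Y) ** Q = c *\<^sub>R (P ** Y ** Q)" for c and Y :: "real^'n^'n"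
    using bounded_linear.linear[OF matrix_mult_bounded_linear(1), of P, THEN linear_cmul]
      bounded_linear.linear[OF matrix_mult_bounded_linear(2), of Q, THEN linear_cmul]
    by metis
  ultimately have "(\<lambda>k. (1 / fact k) *\<^sub>R mat_pow (P ** mdiag d ** Q) k) sums (P ** mdiag (\<lambda>i. exp (d i)) ** Q)"
    by (simp add: mat_pow_similar_mdiag[OF assms])
  with mexp_sums show ?thesis
    by (rule sums_unique2)
qed

lemma complex_eigenvalue_similar_mdiag:
  fixes P Q :: "real^'n^'n"
  assumes "Q ** P = mat 1" and "complex_eigenvalue (P ** mdiag d ** Q) z"
  shows "Im z = 0"
proof -
  obtain v where v: "v \<noteq> 0" "cmat (P ** mdiag d ** Q) *v v = z *s v"
    using assms(2) unfolding complex_eigenvalue_def by blast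
  define w where "w = cmat Q *v v"
  have cI: "cmat (mat 1 :: real^'n^'n) = mat 1"
    by (simp add: vec_eq_iff mat_def)
  have QP: "cmat Q ** cmat P = mat 1"
    by (simp add: assms(1) cI flip: cmat_mult)
  then have PQ: "cmat P ** cmat Q = mat 1"
    by (simp add: matrix_left_right_inverse)
  have "cmat P *v w = v"
    by (simp add: w_def PQ matrix_vector_mul_assoc)
  with v(1) have "w \<noteq> 0" by auto
  then obtain i where i: "w $ i \<noteq> 0"
    by (auto simp: vec_eq_iff)
  have "cmat Q *v (z *s v) = (cmat Q ** cmat P) *v (cmat (mdiag d) *v w)"
    by (simp add: w_def cmat_mult matrix_vector_mul_assoc matrix_mul_assoc flip: v(2))
  then have "z *s w = cmat (mdiag d) *v w"
    by (simp add: QP vec.scale flip: w_def)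
  then have "(z *s w) $ i = (cmat (mdiag d) *v w) $ i"
    by simp
  also have "\<dots> = of_real (d i) * w $ i"
    by (simp add: matrix_vector_mult_def mdiag_nth if_distrib[of "\<lambda>x. of_real x * _"] if_distrib[of of_real] if_distrib[of "\<lambda>x. x * _"] cong: if_cong)
  finally show ?thesis
    using i by simp
qed

lemma matrix_mult_eigenvector_columns:
  fixes Y P :: "real^'n^'n"
  assumes "\<And>j. Y *v column j P = e j *s column j P"
  shows "Y ** P = P ** mdiag e"
proof -
  have "(Y ** P) $ i $ j = (P ** mdiag e) $ i $ j" for i j
  proof -
    have "(Y ** P) $ i $ j = (Y *v column j P) $ i"
      by (simp add: matrix_matrix_mult_def matrix_vector_mult_def column_def)
    then show ?thesis
      by (simp add: assms matrix_mult_mdiag_nth) (simp add: column_def)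
  qed
  then show ?thesis
    by (simp add: vec_eq_iff)
qed

lemma similar_mdiag_mult_column:
  fixes P Q :: "real^'n^'n"
  assumes "Q ** P = mat 1"
  shows "(P ** mdiag d ** Q) *v column j P = d j *s column j P"
proof -
  have "(P ** mdiag d ** Q) *v column j P = (P ** mdiag d ** Q) *v (P *v axis j 1)"
    by (simp only: matrix_vector_mult_basis)
  also have "\<dots> = (P ** mdiag d ** (Q ** P)) *v axis j 1"
    by (simp only: matrix_vector_mul_assoc matrix_mul_assoc)
  also have "\<dots> = column j (P ** mdiag d)"
    by (simp only: assms matrix_mul_rid matrix_vector_mult_basis)
  also have "\<dots> = d j *s column j P"
    by (simp add: column_def vec_eq_iff matrix_mult_mdiag_nth)
  finally show ?thesis .
qed

text \<open>The columns of an invertible \<open>P\<close> form a basis, so the values on them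
  determine a matrix. Uniqueness of the logarithm, uniqueness of the square root and the spectral
  theorem all end with this.\<close>

lemma eq_similar_mdiagI:
  fixes Y P Q :: "real^'n^'n"
  assumes "Q ** P = mat 1" and "\<And>j. Y *v column j P = e j *s column j P"
  shows "Y = P ** mdiag e ** Q"
proof -
  have "P ** Q = mat 1"
    using assms(1) by (simp add: matrix_left_right_inverse)
  then show ?thesis
    by (metis matrix_mult_eigenvector_columns[of Y P e, OF assms(2)] matrix_mul_assoc matrix_mul_rid)
qed

text \<open>The candidate has real spectrum and so meets the strip condition; any other logarithm in
  the strip agrees with it on the columns of \<open>P\<close> by
  \<open>principal_log_eigenvector\<close>. Here \<open>P\<close> is any invertible matrix, so
  nonsymmetric arguments are included.\<close>

lemma mlog_similar_mdiag:
  fixes P Q :: "real^'n^'n"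
  assumes QP: "Q ** P = mat 1" and d: "\<And>i. d i > 0"
  shows "mlog (P ** mdiag d ** Q) = P ** mdiag (\<lambda>i. ln (d i)) ** Q"
  unfolding mlog_def
proof (rule the_equality, intro conjI allI impI)
  show "mexp (P ** mdiag (\<lambda>i. ln (d i)) ** Q) = P ** mdiag d ** Q"
    by (simp add: mexp_similar_mdiag[OF QP] d)
next
  fix z assume "complex_eigenvalue (P ** mdiag (\<lambda>i. ln (d i)) ** Q) z"
  then show "\<bar>Im z\<bar> < pi"
    by (simp add: complex_eigenvalue_similar_mdiag[OF QP])
next
  fix Y assume Y: "mexp Y = P ** mdiag d ** Q \<and> (\<forall>z. complex_eigenvalue Y z \<longrightarrow> \<bar>Im z\<bar> < pi)"
  show "Y = P ** mdiag (\<lambda>i. ln (d i)) ** Q"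
  proof (rule eq_similar_mdiagI[OF QP])
    fix j
    show "Y *v column j P = ln (d j) *s column j P"
      using Y d similar_mdiag_mult_column[OF QP] by (intro principal_log_eigenvector) simp_all
  qed
qed

lemma mlog_similar:
  fixes P Q E F :: "real^'n^'n"
  assumes QP: "Q ** P = mat 1" and d: "\<And>i. d i > 0" and FE: "F ** E = mat 1"
  shows "mlog (E ** (P ** mdiag d ** Q) ** F) = E ** mlog (P ** mdiag d ** Q) ** F"
proof -
  have "(Q ** F) ** (E ** P) = Q ** (F ** E) ** P"
    by (simp only: matrix_mul_assoc)
  then have *: "(Q ** F) ** (E ** P) = mat 1"
    by (simp add: FE QP)
  have "E ** (P ** D ** Q) ** F = (E ** P) ** D ** (Q ** F)" for D
    by (simp only: matrix_mul_assoc)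
  then show ?thesis
    by (simp add: mlog_similar_mdiag[OF QP d] mlog_similar_mdiag[OF * d])
qed

section \<open>Spectral theorem and positive definite matrices\<close>

lemma inner_symmetric_matrix: "transpose A = A \<Longrightarrow> x \<bullet> (A *v y) = (A *v x) \<bullet> y"
  for A :: "real^'n^'n"
  by (metis dot_lmul_matrix transpose_matrix_vector)

text \<open>A maximizer of the Rayleigh quotient on the invariant subspace \<open>B\<^sup>\<bottom>\<close> is an eigenvector.\<close>

lemma symmetric_matrix_eigenvector_orthogonal:
  fixes A :: "real^'n^'n"
  assumes A: "transpose A = A" and eig: "\<And>b. b \<in> B \<Longrightarrow> \<exists>l. A *v b = l *s b"
    and B: "dim B < CARD('n)"
  obtains u l where "norm u = 1" "\<And>b. b \<in> B \<Longrightarrow> b \<bullet> u = 0" "A *v u = l *s u"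
proof -
  define W where "W = {x. \<forall>b\<in>B. b \<bullet> x = 0}"
  have sub: "subspace W"
    by (auto simp: W_def subspace_def inner_add_right)
  have "dim B < DIM(real^'n)"
    using B by simp
  then obtain x0 where x0: "x0 \<noteq> 0" "\<And>y. y \<in> span B \<Longrightarrow> orthogonal x0 y"
    by (rule orthogonal_to_subspace_exists) auto
  then have "x0 \<in> W"
    by (auto simp: W_def orthogonal_def inner_commute span_base)
  define K where "K = W \<inter> sphere 0 1"
  have "compact K"
    unfolding K_def using closed_subspace[OF sub] by (intro closed_Int_compact) auto
  moreover have "(1 / norm x0) *\<^sub>R x0 \<in> K"
    using \<open>x0 \<in> W\<close> x0(1) sub by (auto simp: K_def subspace_mul)
  moreover have "continuous_on K (\<lambda>x. x \<bullet> (A *v x))"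
    by (intro continuous_intros matrix_vector_mult_linear_continuous_on)
  ultimately obtain u where u: "u \<in> K" and max: "\<And>x. x \<in> K \<Longrightarrow> x \<bullet> (A *v x) \<le> u \<bullet> (A *v u)"
    using continuous_attains_sup[of K "\<lambda>x. x \<bullet> (A *v x)"] by blast
  define l where "l = u \<bullet> (A *v u)"
  have uu: "u \<bullet> u = 1" and "u \<in> W" and nu: "norm u = 1"
    using u by (auto simp: K_def dot_square_norm)
  have rayleigh: "x \<bullet> (A *v x) \<le> l * (x \<bullet> x)" if "x \<in> W" for x
  proof (cases "x = 0")
    case False
    define y where "y = (1 / norm x) *\<^sub>R x"
    have "y \<in> K"
      using False that sub by (auto simp: K_def y_def subspace_mul)
    then have "y \<bullet> (A *v y) \<le> l"
      using max by (simp add: l_def)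
    then have "(x \<bullet> (A *v x)) / (norm x)\<^sup>2 \<le> l"
      by (simp add: y_def matrix_vector_mult_scaleR power2_eq_square)
    with False show ?thesis
      by (simp add: dot_square_norm divide_le_eq)
  qed simp
  define w where "w = A *v u - l *\<^sub>R u"
  have AW: "A *v u \<in> W"
    unfolding W_def
  proof (intro CollectI ballI)
    fix b assume b: "b \<in> B"
    then obtain m where "A *v b = m *s b"
      using eig by blast
    then have "A *v b = m *\<^sub>R b"
      by (simp add: scalar_mult_eq_scaleR)
    then show "b \<bullet> (A *v u) = 0"
      using b \<open>u \<in> W\<close> by (simp add: inner_symmetric_matrix[OF A] W_def)
  qed
  then have wW: "w \<in> W"
    using sub \<open>u \<in> W\<close> by (simp add: w_def subspace_diff subspace_mul)
  have wu: "w \<bullet> u = 0"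
    using uu by (simp add: w_def inner_diff_left l_def inner_commute[of "A *v u"])
  have wAu: "w \<bullet> (A *v u) = w \<bullet> w"
  proof -
    have "A *v u = w + l *\<^sub>R u"
      by (simp add: w_def)
    then show ?thesis
      by (simp add: inner_add_right wu)
  qed
  \<comment> \<open>The Rayleigh bound is tested at \<open>u + t *\<^sub>R w\<close>, where
    \<open>w\<close> is the residual: a nonzero residual would yield a first-order gain that the
    second-order term has to absorb.\<close>
  have quad: "2 * t * (w \<bullet> w) \<le> t\<^sup>2 * (l * (w \<bullet> w) - w \<bullet> (A *v w))" for t
  proof -
    have "u + t *\<^sub>R w \<in> W"
      using \<open>u \<in> W\<close> wW sub by (simp add: subspace_add subspace_mul)
    from rayleigh[OF this]
    have "l + t * (u \<bullet> (A *v w)) + t * (w \<bullet> (A *v u)) + t * (t * (w \<bullet> (A *v w))) \<le> l * (1 + t * (t * (w \<bullet> w)))"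
      using wu uu by (simp add: matrix_vector_right_distrib matrix_vector_mult_scaleR inner_add_left
          inner_add_right inner_commute[of u w] l_def distrib_left)
    moreover have "u \<bullet> (A *v w) = w \<bullet> w"
      using wAu by (metis inner_symmetric_matrix[OF A] inner_commute)
    ultimately show ?thesis
      by (simp add: wAu power2_eq_square algebra_simps)
  qed
  have "w = 0"
  proof (rule ccontr)
    assume "w \<noteq> 0"
    then have q: "w \<bullet> w > 0" by simp
    define c where "c = l * (w \<bullet> w) - w \<bullet> (A *v w)"
    \<comment> \<open>With this \<open>t\<close> the second-order side is at most
      \<open>w \<bullet> w\<close>, half of what the bound demands. Adding 1 keeps the denominator
      positive when \<open>c = 0\<close>.\<close>
    define t where "t = (w \<bullet> w) / (\<bar>c\<bar> + 1)"
    have t: "t > 0"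
      using q by (simp add: t_def add_nonneg_pos)
    have "t * (2 * (w \<bullet> w)) \<le> t * (t * c)"
      using quad[of t] by (simp add: c_def power2_eq_square algebra_simps)
    then have "2 * (w \<bullet> w) \<le> t * c"
      using t by simp
    also have "t * c \<le> t * (\<bar>c\<bar> + 1)"
      using t by (intro mult_left_mono) auto
    also have "\<dots> = w \<bullet> w"
      by (simp add: t_def add_nonneg_eq_0_iff)
    finally show False
      using q by simp
  qed
  then have "A *v u = l *s u"
    by (simp add: w_def scalar_mult_eq_scaleR)
  with that[of u l] nu \<open>u \<in> W\<close> show ?thesis
    by (simp add: W_def)
qed

lemma symmetric_matrix_orthonormal_eigenvectors:
  fixes A :: "real^'n^'n"
  assumes A: "transpose A = A" and "k \<le> CARD('n)"
  shows "\<exists>B. finite B \<and> card B = k \<and> (\<forall>b\<in>B. norm b = 1 \<and> (\<exists>l. A *v b = l *s b))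
    \<and> pairwise orthogonal B"
  using assms(2)
proof (induction k)
  case 0
  show ?case
    by (intro exI[of _ "{}"]) auto
next
  case (Suc k)
  then obtain B where B: "finite B" "card B = k" "\<And>b. b \<in> B \<Longrightarrow> norm b = 1"
    "\<And>b. b \<in> B \<Longrightarrow> \<exists>l. A *v b = l *s b" "pairwise orthogonal B"
    by auto
  have "dim B < CARD('n)"
    using dim_le_card'[OF B(1)] B(2) Suc.prems by simp
  from symmetric_matrix_eigenvector_orthogonal[of A B, OF A B(4) this]
  obtain u l where u: "norm u = 1" "\<And>b. b \<in> B \<Longrightarrow> b \<bullet> u = 0" "A *v u = l *s u"
    by blast
  have "u \<notin> B"
    using u(1,2) by (auto simp: norm_eq_1)
  moreover have "orthogonal u b" "orthogonal b u" if "b \<in> B" for b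
    using u(2)[OF that] by (simp_all add: orthogonal_def inner_commute)
  ultimately show ?case
    using B u by (intro exI[of _ "insert u B"]) (auto simp: pairwise_insert)
qed

theorem symmetric_matrix_diagonalization:
  fixes A :: "real^'n^'n"
  assumes "transpose A = A"
  obtains U d where "orthogonal_matrix U" "A = U ** mdiag d ** transpose U"
proof -
  obtain B where B: "finite B" "card B = CARD('n)" "\<And>b. b \<in> B \<Longrightarrow> norm b = 1"
    "\<And>b. b \<in> B \<Longrightarrow> \<exists>l. A *v b = l *s b" "pairwise orthogonal B"
    using symmetric_matrix_orthonormal_eigenvectors[OF assms, of "CARD('n)"] by auto
  obtain g where g: "bij_betw g (UNIV :: 'n set) B"
    using finite_same_card_bij[of "UNIV :: 'n set" B] B(1,2) by auto
  have gB: "g j \<in> B" for j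
    using g by (auto simp: bij_betw_def)
  have "\<forall>j. \<exists>l. A *v g j = l *s g j"
    using B(4) gB by blast
  from choice[OF this] obtain d where d: "\<And>j. A *v g j = d j *s g j"
    by blast
  define U where "U = (\<chi> i j. g j $ i)"
  have col: "column j U = g j" for j
    by (simp add: column_def U_def vec_eq_iff)
  have "orthogonal (g i) (g j)" if "i \<noteq> j" for i j
    using g gB B(5) that by (intro pairwiseD[OF B(5)]) (auto simp: bij_betw_def inj_eq)
  then have U: "orthogonal_matrix U"
    unfolding orthogonal_matrix_orthonormal_columns col
    by (simp add: B(3) gB)
  then have "A = U ** mdiag d ** transpose U"
    by (intro eq_similar_mdiagI) (simp_all add: orthogonal_matrix col d)
  with U show ?thesis
    by (rule that)
qed

section \<open>Positive definite matrices and their square roots\<close>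

lemma spd_symmetric: "spd A \<Longrightarrow> transpose A = A"
  by (simp add: spd_def)

lemma spd_congruence:
  fixes A P Q :: "real^'n^'n"
  assumes "spd A" and "Q ** P = mat 1"
  shows "spd (transpose P ** A ** P)"
  unfolding spd_def
proof (intro conjI allI impI)
  show "transpose (transpose P ** A ** P) = transpose P ** A ** P"
    by (simp add: matrix_transpose_mul spd_symmetric[OF assms(1)] matrix_mul_assoc)
  fix x :: "real^'n" assume "x \<noteq> 0"
  have "Q *v (P *v x) = x"
    by (simp add: assms(2) matrix_vector_mul_assoc)
  with \<open>x \<noteq> 0\<close> have "P *v x \<noteq> 0" by auto
  then have "(P *v x) \<bullet> (A *v (P *v x)) > 0"
    using assms(1) by (simp add: spd_def)
  moreover have "(P *v x) \<bullet> (A *v (P *v x)) = x \<bullet> ((transpose P ** A ** P) *v x)"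
    by (metis dot_lmul_matrix inner_commute matrix_vector_mul_assoc transpose_matrix_vector)
  ultimately show "x \<bullet> ((transpose P ** A ** P) *v x) > 0"
    by simp
qed

lemma spd_mdiag: "(\<And>i. d i > 0) \<Longrightarrow> spd (mdiag d)"
proof -
  assume d: "\<And>i. d i > 0"
  have "x \<bullet> (mdiag d *v x) > 0" if x: "x \<noteq> 0" for x
  proof -
    obtain i where "x $ i \<noteq> 0"
      using x by (auto simp: vec_eq_iff)
    then show ?thesis
      unfolding inner_vec_def using d
      by (intro sum_pos2[of _ i]) (auto simp: mdiag_mult_vec_nth less_imp_le mult.left_commute zero_less_mult_iff intro!: mult_nonneg_nonneg)
  qed
  then show ?thesis
    by (simp add: spd_def)
qed

lemma spd_orthogonal_mdiag:
  assumes "orthogonal_matrix U" "\<And>i. d i > 0"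
  shows "spd (U ** mdiag d ** transpose U)"
  using spd_congruence[OF spd_mdiag, of d U "transpose U"] assms by (simp add: orthogonal_matrix_def)

lemma spd_mdiag_pos:
  fixes U :: "real^'n^'n"
  assumes "spd (U ** mdiag d ** transpose U)" and "orthogonal_matrix U"
  shows "d i > 0"
proof -
  have UU: "transpose U ** U = mat 1"
    using assms(2) by (simp add: orthogonal_matrix)
  have n: "norm (column i U) = 1"
    using assms(2) by (simp add: orthogonal_matrix_orthonormal_columns)
  then have "column i U \<noteq> 0" by auto
  with assms(1) have "column i U \<bullet> ((U ** mdiag d ** transpose U) *v column i U) > 0"
    by (simp add: spd_def)
  then show ?thesis
    using n by (simp add: similar_mdiag_mult_column[OF UU] scalar_mult_eq_scaleR norm_eq_1)
qed

lemma spd_diagonalization: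
  fixes A :: "real^'n^'n"
  assumes "spd A"
  obtains U d where "orthogonal_matrix U" "\<And>i. d i > 0" "A = U ** mdiag d ** transpose U"
proof -
  obtain U d where U: "orthogonal_matrix U" and A: "A = U ** mdiag d ** transpose U"
    using symmetric_matrix_diagonalization[OF spd_symmetric[OF assms]] .
  with spd_mdiag_pos[of U d] assms that[of U d] show ?thesis
    by simp
qed

text \<open>The residual \<open>y\<close> satisfies (B + sqrt a) y = (B^2 - a) v = 0. If nonzero it
  would be an eigenvector of \<open>B\<close> with the negative eigenvalue - sqrt a.\<close>

lemma spd_square_root_eigenvector:
  fixes B :: "real^'n^'n"
  assumes "spd B" and "a > 0" and "(B ** B) *v v = a *s v"
  shows "B *v v = sqrt a *s v"
proof -
  define y where "y = B *v v - sqrt a *\<^sub>R v"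
  have a: "a *s v = sqrt a *\<^sub>R (sqrt a *\<^sub>R v)"
    using assms(2) by (simp add: scalar_mult_eq_scaleR)
  have "B *v y = - (sqrt a *\<^sub>R y)"
    using assms(3) unfolding a
    by (simp add: y_def matrix_vector_mult_diff_distrib matrix_vector_mult_scaleR algebra_simps
        flip: matrix_vector_mul_assoc)
  then have "y \<bullet> (B *v y) = - (sqrt a * (y \<bullet> y))"
    by simp
  also have "\<dots> \<le> 0"
    using assms(2) by simp
  finally have "y = 0"
    using assms(1) by (metis spd_def not_le)
  then show ?thesis
    by (simp add: y_def scalar_mult_eq_scaleR)
qed

lemma msqrt_orthogonal_mdiag:
  fixes U :: "real^'n^'n"
  assumes U: "orthogonal_matrix U" and d: "\<And>i. d i > 0"
  shows "msqrt (U ** mdiag d ** transpose U) = U ** mdiag (\<lambda>i. sqrt (d i)) ** transpose U"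
  unfolding msqrt_def
proof (rule the_equality, intro conjI)
  have UU: "transpose U ** U = mat 1"
    using U by (simp add: orthogonal_matrix)
  show "spd (U ** mdiag (\<lambda>i. sqrt (d i)) ** transpose U)"
    by (rule spd_orthogonal_mdiag[OF U]) (simp add: d)
  show "(U ** mdiag (\<lambda>i. sqrt (d i)) ** transpose U) ** (U ** mdiag (\<lambda>i. sqrt (d i)) ** transpose U)
      = U ** mdiag d ** transpose U"
    using d by (simp add: similar_mdiag_mult[OF UU] less_imp_le)
  fix B assume "spd B \<and> B ** B = U ** mdiag d ** transpose U"
  then show "B = U ** mdiag (\<lambda>i. sqrt (d i)) ** transpose U"
    using d similar_mdiag_mult_column[OF UU] UU
    by (intro eq_similar_mdiagI spd_square_root_eigenvector) simp_all
qed

lemma matrix_inv_unique_left: "B ** A = mat 1 \<Longrightarrow> matrix_inv A = B" for A B :: "real^'n^'n"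
proof -
  assume BA: "B ** A = mat 1"
  then have "A ** B = mat 1"
    by (simp add: matrix_left_right_inverse)
  with BA have "A ** matrix_inv A = mat 1"
    unfolding matrix_inv_def using someI[of "\<lambda>X. A ** X = mat 1 \<and> X ** A = mat 1" B] by simp
  then show "matrix_inv A = B"
    by (metis BA matrix_mul_assoc matrix_mul_lid matrix_mul_rid)
qed

lemma minvsqrt_orthogonal_mdiag:
  fixes U :: "real^'n^'n"
  assumes U: "orthogonal_matrix U" and d: "\<And>i. d i > 0"
  shows "minvsqrt (U ** mdiag d ** transpose U) = U ** mdiag (\<lambda>i. 1 / sqrt (d i)) ** transpose U"
  unfolding minvsqrt_def msqrt_orthogonal_mdiag[OF U d]
proof (rule matrix_inv_unique_left)
  have "1 / sqrt (d i) * sqrt (d i) = 1" for i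
    using d[of i] by simp
  then show "(U ** mdiag (\<lambda>i. 1 / sqrt (d i)) ** transpose U) ** (U ** mdiag (\<lambda>i. sqrt (d i)) ** transpose U) = mat 1"
    using U by (simp only: orthogonal_matrix_def similar_mdiag_mult mdiag_one matrix_mul_rid)
qed

lemma msqrt_spd:
  fixes A :: "real^'n^'n"
  assumes "spd A"
  shows "spd (msqrt A)" "msqrt A ** msqrt A = A" "spd (minvsqrt A)"
    "minvsqrt A ** msqrt A = mat 1" "msqrt A ** minvsqrt A = mat 1"
proof -
  obtain U d where U: "orthogonal_matrix U" and d: "\<And>i. d i > 0" and A: "A = U ** mdiag d ** transpose U"
    using spd_diagonalization[OF assms] by blast
  have UU: "transpose U ** U = mat 1" "U ** transpose U = mat 1"
    using U by (auto simp: orthogonal_matrix_def)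
  show "spd (msqrt A)" "spd (minvsqrt A)"
    unfolding A msqrt_orthogonal_mdiag[OF U d] minvsqrt_orthogonal_mdiag[OF U d]
    by (rule spd_orthogonal_mdiag[OF U], simp add: d)+
  have "sqrt (d i) * sqrt (d i) = d i" "1 / sqrt (d i) * sqrt (d i) = 1" "sqrt (d i) * (1 / sqrt (d i)) = 1" for i
    using d[of i] by simp_all
  then show "msqrt A ** msqrt A = A" "minvsqrt A ** msqrt A = mat 1" "msqrt A ** minvsqrt A = mat 1"
    unfolding A msqrt_orthogonal_mdiag[OF U d] minvsqrt_orthogonal_mdiag[OF U d] similar_mdiag_mult[OF UU(1)]
    by (simp_all only: mdiag_one matrix_mul_rid UU)
qed

section \<open>Critical points of the norm of the logarithm\<close>

text \<open>A Taylor bound at \<open>x\<close> with the exact linear coefficient and a quadratic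
  constant that does not depend on \<open>y\<close>. Writing ln y = ln x + \<delta>, the square of
  \<delta> contributes the 1 in that constant, and replacing \<delta> by (y - x) / x in the mixed
  term contributes \<open>2 * \<bar>ln x\<bar>\<close>.\<close>

lemma ln_square_upper_bound:
  fixes x y m :: real
  assumes m: "m > 0" "x \<ge> m" "y \<ge> m"
  shows "(ln y)\<^sup>2 \<le> (ln x)\<^sup>2 + 2 * ln x / x * (y - x) + (1 + 2 * \<bar>ln x\<bar>) / m\<^sup>2 * (y - x)\<^sup>2"
proof -
  define \<delta> where "\<delta> = ln y - ln x"
  define e where "e = (y - x) / x"
  have pos: "x > 0" "y > 0"
    using m by auto
  have up: "\<delta> \<le> e"
    unfolding \<delta>_def e_def using pos by (intro ln_diff_le)
  have "ln x - ln y \<le> (x - y) / y"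
    using pos by (intro ln_diff_le)
  then have lo: "\<delta> \<ge> (y - x) / y"
    by (simp add: \<delta>_def diff_divide_distrib)
  have q: "(y - x)\<^sup>2 / (x * y) \<le> (y - x)\<^sup>2 / m\<^sup>2"
    unfolding power2_eq_square[of m] using m pos by (intro divide_left_mono mult_mono) auto
  \<comment> \<open>The increment \<delta> lies between (y - x) / y and (y - x) / x, and these two
    differ by (y - x)^2 / (x y).\<close>
  have "e - \<delta> \<le> e - (y - x) / y"
    using lo by simp
  also have "\<dots> = (y - x)\<^sup>2 / (x * y)"
    using pos by (simp add: e_def field_simps power2_eq_square)
  finally have gap: "\<bar>\<delta> - e\<bar> \<le> (y - x)\<^sup>2 / m\<^sup>2"
    using q up by linarith
  have "\<bar>\<delta>\<bar> \<le> \<bar>y - x\<bar> / m"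
  proof -
    have "\<bar>y - x\<bar> / x \<le> \<bar>y - x\<bar> / m" "\<bar>y - x\<bar> / y \<le> \<bar>y - x\<bar> / m"
      using m pos by (auto intro!: divide_left_mono)
    moreover have "e \<le> \<bar>y - x\<bar> / x" "- (\<bar>y - x\<bar> / y) \<le> (y - x) / y"
      using pos by (auto simp: e_def divide_simps)
    ultimately show ?thesis
      using up lo by linarith
  qed
  then have "\<delta>\<^sup>2 \<le> (\<bar>y - x\<bar> / m)\<^sup>2"
    by (metis abs_ge_zero power2_abs power_mono)
  then have sq: "\<delta>\<^sup>2 \<le> (y - x)\<^sup>2 / m\<^sup>2"
    by (simp add: power_divide)
  have "ln x * (\<delta> - e) \<le> \<bar>ln x\<bar> * \<bar>\<delta> - e\<bar>"
    by (metis abs_ge_self abs_mult)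
  also have "\<dots> \<le> \<bar>ln x\<bar> * ((y - x)\<^sup>2 / m\<^sup>2)"
    by (intro mult_left_mono gap) simp
  finally have lin: "ln x * (\<delta> - e) \<le> \<bar>ln x\<bar> * ((y - x)\<^sup>2 / m\<^sup>2)" .
  have "(ln y)\<^sup>2 = (ln x)\<^sup>2 + 2 * (ln x * e) + 2 * (ln x * (\<delta> - e)) + \<delta>\<^sup>2"
    by (simp add: \<delta>_def power2_eq_square algebra_simps)
  also have "\<dots> \<le> (ln x)\<^sup>2 + 2 * (ln x * e) + 2 * (\<bar>ln x\<bar> * ((y - x)\<^sup>2 / m\<^sup>2)) + (y - x)\<^sup>2 / m\<^sup>2"
    using lin sq by linarith
  also have "\<dots> = (ln x)\<^sup>2 + 2 * ln x / x * (y - x) + (1 + 2 * \<bar>ln x\<bar>) / m\<^sup>2 * (y - x)\<^sup>2"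
    by (simp add: e_def algebra_simps add_divide_distrib)
  finally show ?thesis .
qed

section \<open>Frobenius norms and spectral weights in an orthonormal eigenbasis\<close>

lemma norm_matrix_eq_trace: "(norm X)\<^sup>2 = trace (transpose X ** X)" for X :: "real^'n^'n"
  unfolding power2_norm_eq_inner trace_def inner_vec_def
  by (subst sum.swap) (simp add: matrix_matrix_mult_def transpose_def)

lemma norm_orthogonal_conjugation:
  fixes U X :: "real^'n^'n"
  assumes "orthogonal_matrix U"
  shows "norm (U ** X ** transpose U) = norm X"
proof -
  have U: "transpose U ** U = mat 1"
    using assms by (simp add: orthogonal_matrix)
  have "(norm (U ** X ** transpose U))\<^sup>2 = trace (U ** (transpose X ** (transpose U ** U) ** X ** transpose U))"
    by (simp add: norm_matrix_eq_trace matrix_transpose_mul matrix_mul_assoc)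
  also have "\<dots> = trace (transpose X ** X ** (transpose U ** U))"
    by (subst trace_mul_sym) (simp add: U flip: matrix_mul_assoc)
  finally show ?thesis
    by (simp add: U norm_matrix_eq_trace[symmetric])
qed

lemma norm_mdiag: "(norm (mdiag d))\<^sup>2 = (\<Sum>i\<in>UNIV. (d i)\<^sup>2)"
  by (simp add: norm_matrix_eq_trace mdiag_mult_mdiag) (simp add: trace_def mdiag_nth power2_eq_square)

lemma norm_mlog_orthogonal_mdiag:
  assumes "orthogonal_matrix U" and "\<And>i. d i > 0"
  shows "(norm (mlog (U ** mdiag d ** transpose U)))\<^sup>2 = (\<Sum>i\<in>UNIV. (ln (d i))\<^sup>2)"
  using assms
  by (simp add: mlog_similar_mdiag orthogonal_matrix norm_orthogonal_conjugation norm_mdiag)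

lemma norm_orthogonal_mult_vec: "orthogonal_matrix U \<Longrightarrow> norm (U *v x) = norm x" for U :: "real^'n^'n"
  by (simp add: orthogonal_transformation_norm orthogonal_transformation_matrix)

lemma column_inner: "column j V \<bullet> x = (transpose V *v x) $ j" for V :: "real^'n^'n"
  by (simp add: column_def inner_vec_def matrix_vector_mult_def transpose_def del: transpose_matrix_vector)

text \<open>By Parseval the squares are probability weights on the eigenvalues.
  \<open>orthogonal_mdiag_inner\<close> is the mean for these weights and
  \<open>orthogonal_mdiag_residual\<close> the second moment about \<open>l\<close>.\<close>

lemma orthogonal_column_inner_square_sum:
  fixes V :: "real^'n^'n"
  assumes "orthogonal_matrix V" "norm x = 1"
  shows "(\<Sum>j\<in>UNIV. (column j V \<bullet> x)\<^sup>2) = 1"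
proof -
  have "(\<Sum>j\<in>UNIV. (column j V \<bullet> x)\<^sup>2) = (norm (transpose V *v x))\<^sup>2"
    by (simp only: column_inner power2_norm_eq_inner) (simp only: inner_vec_def power2_eq_square inner_real_def)
  also have "\<dots> = (norm x)\<^sup>2"
    using assms(1) by (subst norm_orthogonal_mult_vec) simp_all
  finally show ?thesis
    by (simp add: assms(2))
qed

lemma orthogonal_mdiag_inner:
  fixes V :: "real^'n^'n"
  assumes "orthogonal_matrix V"
  shows "x \<bullet> ((V ** mdiag \<mu> ** transpose V) *v x) = (\<Sum>j\<in>UNIV. \<mu> j * (column j V \<bullet> x)\<^sup>2)"
proof -
  have "x \<bullet> ((V ** mdiag \<mu> ** transpose V) *v x) = x \<bullet> (V *v (mdiag \<mu> *v (transpose V *v x)))"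
    by (simp only: matrix_vector_mul_assoc matrix_mul_assoc)
  also have "\<dots> = (transpose V *v x) \<bullet> (mdiag \<mu> *v (transpose V *v x))"
    by (simp flip: dot_lmul_matrix)
  also have "\<dots> = (\<Sum>j\<in>UNIV. \<mu> j * (column j V \<bullet> x)\<^sup>2)"
    unfolding column_inner
    by (simp only: inner_vec_def inner_real_def mdiag_mult_vec_nth power2_eq_square mult.left_commute)
  finally show ?thesis .
qed

lemma orthogonal_mdiag_residual:
  fixes V :: "real^'n^'n"
  assumes V: "orthogonal_matrix V"
  shows "(norm ((V ** mdiag \<mu> ** transpose V) *v x - l *\<^sub>R x))\<^sup>2
    = (\<Sum>j\<in>UNIV. (\<mu> j - l)\<^sup>2 * (column j V \<bullet> x)\<^sup>2)"
proof -
  have VV: "transpose V ** V = mat 1"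
    using V by (simp add: orthogonal_matrix)
  have "transpose V *v ((V ** mdiag \<mu> ** transpose V) *v x - l *\<^sub>R x)
      = (transpose V ** V) *v (mdiag \<mu> *v (transpose V *v x)) - l *\<^sub>R (transpose V *v x)"
    by (simp only: matrix_vector_mult_diff_distrib matrix_vector_mult_scaleR matrix_vector_mul_assoc matrix_mul_assoc)
  then have *: "transpose V *v ((V ** mdiag \<mu> ** transpose V) *v x - l *\<^sub>R x)
      = mdiag \<mu> *v (transpose V *v x) - l *\<^sub>R (transpose V *v x)"
    by (simp only: VV matrix_vector_mul_lid)
  have "(norm ((V ** mdiag \<mu> ** transpose V) *v x - l *\<^sub>R x))\<^sup>2
      = (norm (transpose V *v ((V ** mdiag \<mu> ** transpose V) *v x - l *\<^sub>R x)))\<^sup>2"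
    using V by (subst norm_orthogonal_mult_vec) simp_all
  also have "\<dots> = (\<Sum>j\<in>UNIV. (\<mu> j - l)\<^sup>2 * (column j V \<bullet> x)\<^sup>2)"
    unfolding * column_inner power2_norm_eq_inner
    by (simp only: inner_vec_def inner_real_def vector_minus_component mdiag_mult_vec_nth vector_scaleR_component
        real_scaleR_def left_diff_distrib[symmetric] power2_eq_square mult.left_commute mult.assoc)
  finally show ?thesis .
qed

lemma orthogonal_mdiag_ge:
  fixes U :: "real^'n^'n"
  assumes "orthogonal_matrix U" "\<And>i. d i \<ge> m" "norm x = 1"
  shows "x \<bullet> ((U ** mdiag d ** transpose U) *v x) \<ge> m"
proof -
  have "m = (\<Sum>j\<in>UNIV. m * (column j U \<bullet> x)\<^sup>2)"
    using assms by (simp add: orthogonal_column_inner_square_sum flip: sum_distrib_left)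
  also have "\<dots> \<le> (\<Sum>j\<in>UNIV. d j * (column j U \<bullet> x)\<^sup>2)"
    by (intro sum_mono mult_right_mono assms) simp
  finally show ?thesis
    using assms by (simp add: orthogonal_mdiag_inner)
qed

text \<open>Expanding each eigenvector of the first matrix in the eigenbasis of the second turns the
  scalar bound \<open>ln_square_upper_bound\<close> into a bound on the trace of \<open>log\<^sup>2\<close> that is smooth in the
  second matrix; no differentiability of the matrix logarithm is needed.\<close>

lemma norm_mlog_upper_bound:
  fixes U V :: "real^'n^'n" and d e :: "'n \<Rightarrow> real"
  defines "A \<equiv> U ** mdiag d ** transpose U" and "B \<equiv> V ** mdiag e ** transpose V"
  assumes U: "orthogonal_matrix U" and V: "orthogonal_matrix V" and m: "m > 0"
    and d: "\<And>i. d i \<ge> m" and e: "\<And>i. e i \<ge> m"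
  shows "(norm (mlog B))\<^sup>2 \<le> (norm (mlog A))\<^sup>2
    + (\<Sum>i\<in>UNIV. 2 * ln (d i) / d i * (column i U \<bullet> ((B - A) *v column i U))
        + (1 + 2 * \<bar>ln (d i)\<bar>) / m\<^sup>2 * (norm ((B - A) *v column i U))\<^sup>2)"
proof -
  have nU: "norm (column i U) = 1" and nV: "norm (column i V) = 1" for i
    using U V by (simp_all add: orthogonal_matrix_orthonormal_columns)
  have AU: "A *v column i U = d i *\<^sub>R column i U" for i
    using U by (simp add: A_def similar_mdiag_mult_column orthogonal_matrix scalar_mult_eq_scaleR)
  let ?p = "\<lambda>i j. (column j V \<bullet> column i U)\<^sup>2"
  let ?K = "\<lambda>i. (1 + 2 * \<bar>ln (d i)\<bar>) / m\<^sup>2"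
  \<comment> \<open>The weights are doubly stochastic. Summing to 1 over \<open>j\<close> lets the
    scalar bound be averaged for a fixed \<open>d i\<close>; summing to 1 over \<open>i\<close>
    recovers the full log-norm of \<open>B\<close> from these averages.\<close>
  have p1: "(\<Sum>j\<in>UNIV. ?p i j) = 1" for i
    by (rule orthogonal_column_inner_square_sum[OF V nU])
  have p2: "(\<Sum>i\<in>UNIV. ?p i j) = 1" for j
    using orthogonal_column_inner_square_sum[OF U nV, of j] by (simp add: inner_commute[of "column j V"])
  have row: "(\<Sum>j\<in>UNIV. ?p i j * (ln (e j))\<^sup>2) \<le> (ln (d i))\<^sup>2
      + 2 * ln (d i) / d i * (column i U \<bullet> ((B - A) *v column i U))
      + ?K i * (norm ((B - A) *v column i U))\<^sup>2" for i
  proof -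
    have "(\<Sum>j\<in>UNIV. ?p i j * (ln (e j))\<^sup>2) \<le> (\<Sum>j\<in>UNIV. ?p i j *
        ((ln (d i))\<^sup>2 + 2 * ln (d i) / d i * (e j - d i) + ?K i * (e j - d i)\<^sup>2))"
      by (intro sum_mono mult_left_mono ln_square_upper_bound m d e) simp
    also have "\<dots> = (\<Sum>j\<in>UNIV. (ln (d i))\<^sup>2 * ?p i j + 2 * ln (d i) / d i * (e j * ?p i j - d i * ?p i j)
        + ?K i * ((e j - d i)\<^sup>2 * ?p i j))"
      by (intro sum.cong refl) (simp only: distrib_left distrib_right left_diff_distrib right_diff_distrib mult_ac)
    also have "\<dots> = (ln (d i))\<^sup>2 + 2 * ln (d i) / d i * ((\<Sum>j\<in>UNIV. e j * ?p i j) - d i)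
        + ?K i * (\<Sum>j\<in>UNIV. (e j - d i)\<^sup>2 * ?p i j)"
      by (simp only: sum.distrib sum_subtractf sum_distrib_left[symmetric] p1 mult_1_right)
    also have "(\<Sum>j\<in>UNIV. e j * ?p i j) = column i U \<bullet> (B *v column i U)"
      unfolding B_def by (rule orthogonal_mdiag_inner[OF V, symmetric])
    also have "(\<Sum>j\<in>UNIV. (e j - d i)\<^sup>2 * ?p i j) = (norm ((B - A) *v column i U))\<^sup>2"
      using orthogonal_mdiag_residual[OF V, of e "column i U" "d i"]
      by (simp add: matrix_vector_mult_diff_rdistrib AU flip: B_def)
    also have "column i U \<bullet> (B *v column i U) - d i = column i U \<bullet> ((B - A) *v column i U)"
      using nU[of i] by (simp add: matrix_vector_mult_diff_rdistrib AU inner_diff_right norm_eq_1)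
    finally show ?thesis .
  qed
  have pos: "d i > 0" "e i > 0" for i
    using m d[of i] e[of i] by auto
  have "(norm (mlog B))\<^sup>2 = (\<Sum>j\<in>UNIV. \<Sum>i\<in>UNIV. ?p i j * (ln (e j))\<^sup>2)"
    using V pos by (simp add: B_def norm_mlog_orthogonal_mdiag p2 flip: sum_distrib_right)
  also have "\<dots> = (\<Sum>i\<in>UNIV. \<Sum>j\<in>UNIV. ?p i j * (ln (e j))\<^sup>2)"
    by (rule sum.swap)
  also have "\<dots> \<le> (\<Sum>i\<in>UNIV. (ln (d i))\<^sup>2
      + 2 * ln (d i) / d i * (column i U \<bullet> ((B - A) *v column i U))
      + ?K i * (norm ((B - A) *v column i U))\<^sup>2)"
    by (rule sum_mono[OF row])
  also have "\<dots> = (norm (mlog A))\<^sup>2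
    + (\<Sum>i\<in>UNIV. 2 * ln (d i) / d i * (column i U \<bullet> ((B - A) *v column i U))
        + ?K i * (norm ((B - A) *v column i U))\<^sup>2)"
    using U pos by (simp add: A_def norm_mlog_orthogonal_mdiag sum.distrib)
  finally show ?thesis .
qed

lemma norm_matrix_mult_vec_le: "norm (A *v x) \<le> norm A * norm x" for A :: "real^'n^'m"
proof -
  have "norm (A *v x) \<le> L2_set (\<lambda>i. norm (A $ i) * norm x) UNIV"
    unfolding norm_vec_def[of "A *v x"]
    by (rule L2_set_mono) (auto simp: matrix_vector_mul_component Cauchy_Schwarz_ineq2)
  then show ?thesis
    by (simp add: norm_vec_def[of A] flip: L2_set_left_distrib)
qed

text \<open>A first-variation formula: only the linear part of the majorant \<open>F\<close> has a
  derivative at \<open>t\<close>, and summed over the eigenvectors of \<open>W t\<close> it equals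
  twice the stated trace.\<close>

theorem norm_mlog_stationary:
  fixes W :: "real \<Rightarrow> real^'n^'n"
  assumes spd: "\<And>s. spd (W s)"
    and deriv: "\<And>i j. ((\<lambda>s. W s $ i $ j) has_real_derivative W' $ i $ j) (at t)"
    and min: "\<And>s. norm (mlog (W t)) \<le> norm (mlog (W s))"
  shows "trace (mlog (W t) ** matrix_inv (W t) ** W') = 0"
proof -
  obtain U d where U: "orthogonal_matrix U" and d: "\<And>i. d i > 0" and Wt: "W t = U ** mdiag d ** transpose U"
    using spd_diagonalization[OF spd[of t]] by blast
  have UU: "transpose U ** U = mat 1"
    using U by (simp add: orthogonal_matrix)
  have nU: "norm (column i U) = 1" for i
    using U by (simp add: orthogonal_matrix_orthonormal_columns)
  \<comment> \<open>Half the least eigenvalue: when \<open>W s\<close> is within \<open>m\<close> of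
    \<open>W t\<close>, its eigenvalues are still at least 2 m - m = m, so one quadratic constant
    serves all nearby \<open>s\<close>.\<close>
  define m where "m = Min (range d) / 2"
  have m2: "d i \<ge> 2 * m" for i
    by (simp add: m_def)
  have m: "m > 0"
    using d by (simp add: m_def)
  let ?k = "\<lambda>i. 2 * ln (d i) / d i"
  let ?K = "\<lambda>i. (1 + 2 * \<bar>ln (d i)\<bar>) / m\<^sup>2"
  define F where "F s = (norm (mlog (W t)))\<^sup>2
    + (\<Sum>i\<in>UNIV. ?k i * (column i U \<bullet> ((W s - W t) *v column i U))
        + ?K i * (norm ((W s - W t) *v column i U))\<^sup>2)" for s
  have "(W \<longlongrightarrow> W t) (at t)"
    using DERIV_isCont[OF deriv] by (intro vec_tendstoI) (simp add: isCont_def)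
  then obtain \<delta> where \<delta>: "\<delta> > 0" "\<And>s. s \<noteq> t \<Longrightarrow> dist s t < \<delta> \<Longrightarrow> dist (W s) (W t) < m"
    using m unfolding tendsto_iff eventually_at by (metis UNIV_I)
  have F_ge: "F t \<le> F s" if "\<bar>t - s\<bar> < \<delta>" for s
  proof -
    have near: "norm (W s - W t) < m"
      using \<delta>(2)[of s] that m by (cases "s = t") (auto simp: dist_norm abs_minus_commute)
    obtain V e where V: "orthogonal_matrix V" and e: "\<And>i. e i > 0" and Ws: "W s = V ** mdiag e ** transpose V"
      using spd_diagonalization[OF spd[of s]] by blast
    have em: "e j \<ge> m" for j
    proof -
      let ?v = "column j V"
      have nv: "norm ?v = 1"
        using V by (simp add: orthogonal_matrix_orthonormal_columns)
      have "e j = ?v \<bullet> (W s *v ?v)"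
        using V nv by (simp add: Ws similar_mdiag_mult_column orthogonal_matrix scalar_mult_eq_scaleR norm_eq_1)
      also have "\<dots> = ?v \<bullet> (W t *v ?v) + ?v \<bullet> ((W s - W t) *v ?v)"
        by (simp add: matrix_vector_mult_diff_rdistrib inner_diff_right)
      finally have *: "e j = ?v \<bullet> (W t *v ?v) + ?v \<bullet> ((W s - W t) *v ?v)" .
      have "?v \<bullet> (W t *v ?v) \<ge> 2 * m"
        unfolding Wt by (rule orthogonal_mdiag_ge[OF U m2 nv])
      moreover have "\<bar>?v \<bullet> ((W s - W t) *v ?v)\<bar> \<le> norm (W s - W t)"
        using Cauchy_Schwarz_ineq2[of ?v "(W s - W t) *v ?v"] norm_matrix_mult_vec_le[of "W s - W t" ?v] nv
        by simp
      ultimately show ?thesis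
        using near * by linarith
    qed
    have dm: "d i \<ge> m" for i
      using m2[of i] m by linarith
    have "F t = (norm (mlog (W t)))\<^sup>2"
      by (simp add: F_def)
    also have "\<dots> \<le> (norm (mlog (W s)))\<^sup>2"
      by (intro power_mono min) simp
    also have "\<dots> \<le> F s"
      unfolding F_def Ws Wt by (rule norm_mlog_upper_bound[OF U V m dm em])
    finally show ?thesis .
  qed
  have lin: "((\<lambda>s. ((W s - W t) *v x) $ a) has_real_derivative (W' *v x) $ a) (at t)" for x a
    unfolding matrix_vector_mult_def
    by (auto intro!: derivative_eq_intros deriv)
  \<comment> \<open>Every component of the increment vanishes at \<open>t\<close>, so each
    product-rule term of its squared norm does too.\<close>
  have quad: "((\<lambda>s. (norm ((W s - W t) *v x))\<^sup>2) has_real_derivative 0) (at t)" for x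
    unfolding power2_norm_eq_inner inner_vec_def
    by (auto intro!: derivative_eq_intros lin)
  have "((\<lambda>s. x \<bullet> ((W s - W t) *v x)) has_real_derivative x \<bullet> (W' *v x)) (at t)" for x
    unfolding inner_vec_def
    by (auto intro!: derivative_eq_intros lin simp: mult.commute)
  then have "(F has_real_derivative 0 + (\<Sum>i\<in>UNIV. ?k i * (column i U \<bullet> (W' *v column i U)) + ?K i * 0)) (at t)"
    unfolding F_def by (intro DERIV_add DERIV_const DERIV_sum DERIV_cmult quad)
  then have "0 + (\<Sum>i\<in>UNIV. ?k i * (column i U \<bullet> (W' *v column i U)) + ?K i * 0) = 0"
    using \<delta>(1) by (rule DERIV_local_min) (use F_ge in blast)
  then have 0: "(\<Sum>i\<in>UNIV. ?k i * (column i U \<bullet> (W' *v column i U))) = 0"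
    by simp
  have entry: "(transpose U ** W' ** U) $ i $ i = column i U \<bullet> (W' *v column i U)" for i
  proof -
    have "column i (transpose U ** W' ** U) = transpose U *v (W' *v column i U)"
      by (simp only: matrix_vector_mul_assoc matrix_mul_assoc flip: matrix_vector_mult_basis)
    then show ?thesis
      by (simp only: column_inner) (simp add: column_def vec_eq_iff)
  qed
  have "matrix_inv (W t) = U ** mdiag (\<lambda>i. 1 / d i) ** transpose U"
    unfolding Wt
  proof (rule matrix_inv_unique_left)
    have "1 / d i * d i = 1" for i
      using d[of i] by simp
    then show "(U ** mdiag (\<lambda>i. 1 / d i) ** transpose U) ** (U ** mdiag d ** transpose U) = mat 1"
      using U by (simp only: orthogonal_matrix_def similar_mdiag_mult mdiag_one matrix_mul_rid)
  qed
  then have "mlog (W t) ** matrix_inv (W t) = U ** mdiag (\<lambda>i. ln (d i) / d i) ** transpose U"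
    by (simp add: Wt mlog_similar_mdiag[OF UU d] similar_mdiag_mult[OF UU])
  then have "trace (mlog (W t) ** matrix_inv (W t) ** W')
      = trace (U ** (mdiag (\<lambda>i. ln (d i) / d i) ** (transpose U ** W')))"
    by (simp add: matrix_mul_assoc)
  also have "\<dots> = trace (mdiag (\<lambda>i. ln (d i) / d i) ** (transpose U ** W' ** U))"
    by (subst trace_mul_sym) (simp add: matrix_mul_assoc)
  also have "\<dots> = (\<Sum>i\<in>UNIV. ln (d i) / d i * (column i U \<bullet> (W' *v column i U)))"
    unfolding trace_def mdiag_mult_matrix_nth
    by (simp only: entry)
  also have "\<dots> = 1 / 2 * (\<Sum>i\<in>UNIV. ?k i * (column i U \<bullet> (W' *v column i U)))"
    unfolding sum_distrib_left by (rule sum.cong) simp_all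
  also have "\<dots> = 0"
    by (simp only: 0 mult_zero_right)
  finally show ?thesis .
qed

section \<open>Distance and metric\<close>

lemma matrix_mult_cancel_right: "A ** B = mat 1 \<Longrightarrow> X ** A ** B = X"
  for A :: "real^'n^'n"
  by (simp flip: matrix_mul_assoc)

lemma mpowr_similar_mdiag:
  fixes P Q :: "real^'n^'n"
  assumes "Q ** P = mat 1" and "\<And>i. d i > 0"
  shows "mpowr (P ** mdiag d ** Q) t = P ** mdiag (\<lambda>i. exp (t * ln (d i))) ** Q"
proof -
  have "t *\<^sub>R mdiag e = mdiag (\<lambda>i. t * e i)" for e :: "'n \<Rightarrow> real"
    by (simp add: vec_eq_iff mdiag_nth)
  then have "t *\<^sub>R mlog (P ** mdiag d ** Q) = P ** mdiag (\<lambda>i. t * ln (d i)) ** Q"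
    unfolding mlog_similar_mdiag[OF assms] by (metis matrix_scalar_ac scalar_matrix_assoc)
  then show ?thesis
    by (simp add: mpowr_def mexp_similar_mdiag[OF assms(1)])
qed

text \<open>\<open>E\<close> need not be orthogonal, so the argument of the logarithm may be
  nonsymmetric; this is the form that reaches the product of \<open>Z\<close> with a power of
  \<open>L\<close>.\<close>

lemma mlog_spd_similar:
  fixes A E F :: "real^'n^'n"
  assumes "spd A" and "F ** E = mat 1"
  shows "mlog (E ** A ** F) = E ** mlog A ** F"
proof -
  obtain U d where U: "orthogonal_matrix U" "\<And>i. d i > 0" "A = U ** mdiag d ** transpose U"
    using spd_diagonalization[OF assms(1)] by blast
  with mlog_similar[OF _ U(2) assms(2), of "transpose U" U] show ?thesis
    by (simp add: orthogonal_matrix)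
qed

lemma mlog_commute_spd:
  fixes A :: "real^'n^'n"
  assumes "spd A"
  shows "A ** mlog A = mlog A ** A"
proof -
  obtain U d where U: "orthogonal_matrix U" "\<And>i. d i > 0" "A = U ** mdiag d ** transpose U"
    using spd_diagonalization[OF assms] by blast
  then have "transpose U ** U = mat 1"
    by (simp add: orthogonal_matrix)
  then show ?thesis
    unfolding U(3) mlog_similar_mdiag[OF \<open>transpose U ** U = mat 1\<close> U(2)]
    by (simp add: similar_mdiag_mult mult.commute)
qed

lemma spd_matrix_inv:
  fixes A :: "real^'n^'n"
  assumes "spd A"
  shows "matrix_inv A = minvsqrt A ** minvsqrt A" "matrix_inv A ** A = mat 1" "A ** matrix_inv A = mat 1"
proof -
  note S = msqrt_spd[OF assms]
  have "minvsqrt A ** minvsqrt A ** A = minvsqrt A ** minvsqrt A ** (msqrt A ** msqrt A)"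
    by (simp add: S)
  also have "\<dots> = mat 1"
    by (simp add: matrix_mul_assoc matrix_mult_cancel_right S(4))
  finally have *: "minvsqrt A ** minvsqrt A ** A = mat 1" .
  then show "matrix_inv A = minvsqrt A ** minvsqrt A"
    by (rule matrix_inv_unique_left)
  with * show "matrix_inv A ** A = mat 1"
    by simp
  then show "A ** matrix_inv A = mat 1"
    by (simp add: matrix_left_right_inverse)
qed

text \<open>The hypothesis on \<open>F\<close> makes \<open>msqrt A ** F\<close> orthogonal.
  Conjugating by it turns the matrix in the definition of the distance into
  \<open>transpose F ** B ** F\<close> and preserves the norm of the logarithm.\<close>

lemma spd_dist_congruence:
  fixes A B F :: "real^'n^'n"
  assumes A: "spd A" and B: "spd B" and F: "transpose F ** A ** F = mat 1"
  shows "spd_dist A B = norm (mlog (transpose F ** B ** F))"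
proof -
  note S = msqrt_spd[OF A]
  note sym = spd_symmetric[OF S(1)] spd_symmetric[OF S(3)]
  define E where "E = msqrt A ** F"
  have "transpose E ** E = transpose F ** (msqrt A ** msqrt A) ** F"
    by (simp add: E_def matrix_transpose_mul sym matrix_mul_assoc)
  then have E: "orthogonal_matrix E"
    by (simp add: orthogonal_matrix S(2) F)
  have "spd (minvsqrt A ** B ** minvsqrt A)"
    using spd_congruence[OF B S(5)] by (simp add: sym)
  then have "mlog (transpose E ** (minvsqrt A ** B ** minvsqrt A) ** E)
      = transpose E ** mlog (minvsqrt A ** B ** minvsqrt A) ** E"
    using E by (intro mlog_spd_similar) (simp_all add: orthogonal_matrix_def)
  moreover have "transpose E ** (minvsqrt A ** B ** minvsqrt A) ** E = transpose F ** B ** F"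
    by (simp add: E_def matrix_transpose_mul sym matrix_mul_assoc matrix_mult_cancel_right S)
  ultimately have "norm (mlog (transpose F ** B ** F)) = norm (transpose E ** mlog (minvsqrt A ** B ** minvsqrt A) ** E)"
    by simp
  also have "\<dots> = norm (mlog (minvsqrt A ** B ** minvsqrt A))"
    using norm_orthogonal_conjugation[of "transpose E"] E by simp
  finally show ?thesis
    by (simp add: spd_dist_def)
qed

lemma spd_metric_spd_log:
  fixes A B C :: "real^'n^'n"
  assumes "spd A"
  shows "spd_metric A (spd_log A B) (spd_log A C)
    = trace (mlog (minvsqrt A ** B ** minvsqrt A) ** mlog (minvsqrt A ** C ** minvsqrt A))"
proof -
  note S = msqrt_spd[OF assms]
  let ?J = "mlog (minvsqrt A ** B ** minvsqrt A)" and ?K = "mlog (minvsqrt A ** C ** minvsqrt A)"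
  have "spd_metric A (spd_log A B) (spd_log A C) = trace ((msqrt A ** ?J ** ?K) ** minvsqrt A)"
    unfolding spd_metric_def spd_log_def spd_matrix_inv(1)[OF assms]
    by (simp add: matrix_mul_assoc matrix_mult_cancel_right S)
  also have "\<dots> = trace (?J ** ?K)"
    by (subst trace_mul_sym) (simp add: matrix_mul_assoc S)
  finally show ?thesis .
qed

lemma trace_orthogonal_conjugation_mult:
  fixes U X Y :: "real^'n^'n"
  assumes "transpose U ** U = mat 1"
  shows "trace ((U ** X ** transpose U) ** (U ** Y ** transpose U)) = trace (X ** Y)"
proof -
  have "trace ((U ** X ** transpose U) ** (U ** Y ** transpose U)) = trace ((U ** X ** Y) ** transpose U)"
    by (simp add: matrix_mul_assoc matrix_mult_cancel_right assms)
  also have "\<dots> = trace (X ** Y)"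
    by (subst trace_mul_sym) (simp add: matrix_mul_assoc assms)
  finally show ?thesis .
qed

lemma norm_mlog_diagonal_flow_stationary:
  fixes Z :: "real^'n^'n" and h :: "'n \<Rightarrow> real"
  defines "W \<equiv> \<lambda>s. mdiag (\<lambda>i. exp (- s / 2 * h i)) ** Z ** mdiag (\<lambda>i. exp (- s / 2 * h i))"
  assumes spd: "\<And>s. spd (W s)" and min: "\<And>s. norm (mlog (W t)) \<le> norm (mlog (W s))"
  shows "trace (mlog (W t) ** mdiag h) = 0"
proof -
  \<comment> \<open>This is the derivative of the two-sided flow. Its two halves contribute equally
    to the trace: cyclicity and the commutation of \<open>W t\<close> with its logarithm cancel
    \<open>W t\<close> against its inverse in both.\<close>
  define W' where "W' = (- 1 / 2) *\<^sub>R (mdiag h ** W t + W t ** mdiag h)"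
  have "((\<lambda>s. W s $ i $ j) has_real_derivative W' $ i $ j) (at t)" for i j
    unfolding W_def W'_def
    by (auto intro!: derivative_eq_intros simp: mdiag_mult_matrix_nth matrix_mult_mdiag_nth field_simps)
  from norm_mlog_stationary[OF spd this min]
  have 0: "trace (mlog (W t) ** matrix_inv (W t) ** W') = 0" .
  note inv = spd_matrix_inv[OF spd[of t]]
  have "trace (mlog (W t) ** matrix_inv (W t) ** (mdiag h ** W t))
      = trace ((mlog (W t) ** matrix_inv (W t) ** mdiag h) ** W t)"
    by (simp add: matrix_mul_assoc)
  also have "\<dots> = trace (W t ** mlog (W t) ** matrix_inv (W t) ** mdiag h)"
    by (subst trace_mul_sym) (simp add: matrix_mul_assoc)
  also have "\<dots> = trace (mlog (W t) ** mdiag h)"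
    by (simp add: mlog_commute_spd[OF spd] matrix_mult_cancel_right inv(2,3))
  finally have 1: "trace (mlog (W t) ** matrix_inv (W t) ** (mdiag h ** W t)) = trace (mlog (W t) ** mdiag h)" .
  have 2: "trace (mlog (W t) ** matrix_inv (W t) ** (W t ** mdiag h)) = trace (mlog (W t) ** mdiag h)"
    by (simp add: matrix_mul_assoc matrix_mult_cancel_right inv(2,3))
  have "mlog (W t) ** matrix_inv (W t) ** W' = (- 1 / 2) *\<^sub>R
      (mlog (W t) ** matrix_inv (W t) ** (mdiag h ** W t) + mlog (W t) ** matrix_inv (W t) ** (W t ** mdiag h))"
    by (simp only: W'_def matrix_scalar_ac scalar_matrix_assoc[symmetric] matrix_add_ldistrib scaleR_add_right)
  moreover have "trace (c *\<^sub>R X) = c * trace X" for c and X :: "real^'n^'n"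
    by (simp add: trace_def sum_distrib_left)
  ultimately have "trace (mlog (W t) ** matrix_inv (W t) ** W') = (- 1 / 2) * (2 * trace (mlog (W t) ** mdiag h))"
    by (simp only: trace_add 1 2 mult_2)
  with 0 show ?thesis
    by simp
qed

theorem proposition3p3:
  fixes A1 A2 C U L Z :: "real^'n^'n"
    and R :: "real \<Rightarrow> real^'n^'n"
  assumes "spd A1" and "spd A2" and "spd C"
    and "orthogonal_matrix U"
    and "\<forall>i j. i \<noteq> j \<longrightarrow> L $ i $ j = 0"
    and "minvsqrt A1 ** A2 ** minvsqrt A1 = U ** L ** transpose U"
    and "Z = transpose U ** minvsqrt A1 ** C ** minvsqrt A1 ** U"
    and "\<forall>t. R t = mpowr (minvsqrt A1 ** A2 ** minvsqrt A1) t"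
  shows "(\<forall>tstar::real.
            (\<forall>t::real. spd_dist (spd_geodesic A1 A2 tstar) C \<le> spd_dist (spd_geodesic A1 A2 t) C)
            \<longrightarrow> trace (mlog (Z ** mpowr L (- tstar)) ** mlog L) = 0)
       \<and> (\<forall>tstar::real.
            trace (mlog (Z ** mpowr L (- tstar)) ** mlog L) = 0
            \<longleftrightarrow> spd_metric (R tstar)
                  (spd_log (R tstar) (minvsqrt A1 ** C ** minvsqrt A1))
                  (spd_log (R tstar) (R (1 + tstar))) = 0)
       \<and> (\<forall>t::real. R t = minvsqrt A1 ** spd_geodesic A1 A2 t ** minvsqrt A1)"
proof -
  define S where "S = msqrt A1"
  define T where "T = minvsqrt A1"
  have TS: "T ** S = mat 1" and ST: "S ** T = mat 1"
    and St: "transpose S = S" and Tt: "transpose T = T"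
    using msqrt_spd[OF assms(1)] by (simp_all add: S_def T_def spd_symmetric)
  have UU: "transpose U ** U = mat 1" and UU': "U ** transpose U = mat 1"
    using assms(4) by (simp_all add: orthogonal_matrix_def)
  define l where "l i = L $ i $ i" for i
  define h where "h = (\<lambda>i. ln (l i))"
  define D where "D t = mdiag (\<lambda>i. exp (t * h i))" for t
  have L: "L = mdiag l"
    using assms(5) by (simp add: vec_eq_iff mdiag_nth l_def)
  have G: "T ** A2 ** T = U ** mdiag l ** transpose U"
    using assms(6) by (simp add: T_def L)
  \<comment> \<open>The assumptions only say that \<open>L\<close> is diagonal; positivity of its
    entries is inherited from \<open>A2\<close> by congruence.\<close>
  have "spd (U ** mdiag l ** transpose U)"
    using spd_congruence[OF assms(2) ST] by (simp add: Tt G)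
  then have l: "l i > 0" for i
    using assms(4) by (rule spd_mdiag_pos)
  have D_add: "D a ** D b = D (a + b)" for a b
    by (simp add: D_def mdiag_mult_mdiag distrib_right exp_add)
  have D_0: "D 0 = mat 1"
    by (simp add: D_def mdiag_one)
  have D_add': "X ** D a ** D b = X ** D (a + b)" for X :: "real^'n^'n" and a b
    by (simp add: D_add flip: matrix_mul_assoc)
  have Dt: "transpose (D a) = D a" for a
    by (simp add: D_def)
  have L_log: "mlog L = mdiag h"
    using mlog_similar_mdiag[of "mat 1" "mat 1" l] l by (simp add: L h_def)
  have L_pow: "mpowr L t = D t" for t
    using mpowr_similar_mdiag[of "mat 1" "mat 1" l t] l by (simp add: L D_def h_def)
  have R: "R t = U ** D t ** transpose U" for t
    using assms(8) mpowr_similar_mdiag[OF UU, of l t] l by (simp add: G D_def h_def flip: T_def)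
  have spd_R: "spd (R t)" for t
    unfolding R D_def by (rule spd_orthogonal_mdiag[OF assms(4)]) simp
  have geo: "spd_geodesic A1 A2 t = S ** R t ** S" for t
    using assms(8) by (simp add: spd_geodesic_def S_def)
  have spd_geo: "spd (spd_geodesic A1 A2 t)" for t
    using spd_congruence[OF spd_R TS] by (simp add: St geo)
  have Z: "Z = transpose (T ** U) ** C ** (T ** U)"
    by (simp add: assms(7) matrix_transpose_mul Tt matrix_mul_assoc flip: T_def)
  have "(transpose U ** S) ** (T ** U) = mat 1"
    by (simp add: matrix_mul_assoc matrix_mult_cancel_right ST UU)
  from spd_congruence[OF assms(3) this] have spd_Z: "spd Z"
    by (simp add: Z)
  define W where "W s = D (- s / 2) ** Z ** D (- s / 2)" for s
  have spd_W: "spd (W s)" for s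
    unfolding W_def using spd_congruence[OF spd_Z, of "D (s / 2)" "D (- s / 2)"]
    by (simp add: D_add D_0 Dt)
  have W_alt: "W = (\<lambda>s. mdiag (\<lambda>i. exp (- s / 2 * h i)) ** Z ** mdiag (\<lambda>i. exp (- s / 2 * h i)))"
    by (simp add: fun_eq_iff W_def D_def)

  have dist: "spd_dist (spd_geodesic A1 A2 s) C = norm (mlog (W s))" for s
  proof -
    \<comment> \<open>The geodesic point is \<open>S ** U ** D s ** transpose U ** S\<close>, so
      this factor strips \<open>S\<close> and \<open>U\<close> and leaves the exponents - s/2 + s -
      s/2 = 0.\<close>
    define F where "F = T ** U ** D (- s / 2)"
    have "transpose F ** spd_geodesic A1 A2 s ** F = mat 1"
      by (simp add: F_def geo R matrix_transpose_mul Tt Dt matrix_mul_assoc matrix_mult_cancel_right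
          TS ST UU D_add D_add' D_0)
    from spd_dist_congruence[OF spd_geo assms(3) this]
    show ?thesis
      by (simp add: F_def W_def Z matrix_transpose_mul Dt matrix_mul_assoc)
  qed

  have tr: "trace (mlog (Z ** mpowr L (- t)) ** mlog L) = trace (mlog (W t) ** mdiag h)" for t
  proof -
    \<comment> \<open>Moving half of the power across is a similarity by \<open>D (t / 2)\<close>.
      It leaves the trace against \<open>mdiag h\<close> unchanged because diagonal matrices
      commute.\<close>
    have "Z ** mpowr L (- t) = D (t / 2) ** W t ** D (- t / 2)"
      by (simp add: W_def L_pow matrix_mul_assoc D_add D_add' D_0)
    moreover have "D (- t / 2) ** D (t / 2) = mat 1"
      by (simp add: D_add D_0)
    ultimately have "mlog (Z ** mpowr L (- t)) = D (t / 2) ** mlog (W t) ** D (- t / 2)"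
      by (simp add: mlog_spd_similar[OF spd_W])
    then have "trace (mlog (Z ** mpowr L (- t)) ** mlog L)
        = trace (D (t / 2) ** (mlog (W t) ** D (- t / 2) ** mdiag h))"
      by (simp add: L_log matrix_mul_assoc)
    also have "\<dots> = trace (mlog (W t) ** (D (- t / 2) ** mdiag h ** D (t / 2)))"
      by (subst trace_mul_sym) (simp add: matrix_mul_assoc)
    also have "D (- t / 2) ** mdiag h ** D (t / 2) = mdiag h"
      by (simp add: D_def mdiag_mult_mdiag exp_minus field_simps)
    finally show ?thesis .
  qed

  have orth: "spd_metric (R t) (spd_log (R t) (minvsqrt A1 ** C ** minvsqrt A1)) (spd_log (R t) (R (1 + t)))
      = trace (mlog (W t) ** mdiag h)" for t
  proof -
    have "1 / sqrt (exp (t * h i)) = exp (- t / 2 * h i)" for i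
      by (simp add: exp_minus inverse_eq_divide real_sqrt_unique flip: exp_add power2_eq_square exp_double)
    then have Q: "minvsqrt (R t) = U ** D (- t / 2) ** transpose U"
      unfolding R D_def by (subst minvsqrt_orthogonal_mdiag[OF assms(4)]) simp_all
    have "minvsqrt A1 ** C ** minvsqrt A1 = U ** Z ** transpose U"
      by (simp add: Z matrix_transpose_mul Tt matrix_mul_assoc matrix_mult_cancel_right UU' flip: T_def)
    then have "minvsqrt (R t) ** (minvsqrt A1 ** C ** minvsqrt A1) ** minvsqrt (R t) = U ** W t ** transpose U"
      by (simp add: Q W_def matrix_mul_assoc matrix_mult_cancel_right UU)
    then have 1: "mlog (minvsqrt (R t) ** (minvsqrt A1 ** C ** minvsqrt A1) ** minvsqrt (R t))
        = U ** mlog (W t) ** transpose U"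
      by (simp add: mlog_spd_similar[OF spd_W UU])
    \<comment> \<open>All factors are powers of one matrix, so the exponents add up to - t/2 + (1 +
      t) - t/2 = 1 for every \<open>t\<close>, and the direction of the geodesic always appears as
      log Lambda.\<close>
    have "minvsqrt (R t) ** R (1 + t) ** minvsqrt (R t) = U ** D 1 ** transpose U"
      unfolding Q unfolding R by (simp add: matrix_mul_assoc matrix_mult_cancel_right UU D_add')
    also have "D 1 = mdiag l"
      by (simp add: D_def h_def l)
    finally have 2: "mlog (minvsqrt (R t) ** R (1 + t) ** minvsqrt (R t)) = U ** mdiag h ** transpose U"
      by (simp add: mlog_similar_mdiag[OF UU] l h_def)
    show ?thesis
      unfolding spd_metric_spd_log[OF spd_R] 1 2 by (rule trace_orthogonal_conjugation_mult[OF UU])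
  qed

  have "trace (mlog (W t) ** mdiag h) = 0"
    if "\<forall>s. spd_dist (spd_geodesic A1 A2 t) C \<le> spd_dist (spd_geodesic A1 A2 s) C" for t
    using that spd_W unfolding dist W_alt by (intro norm_mlog_diagonal_flow_stationary) auto
  moreover have "R t = minvsqrt A1 ** spd_geodesic A1 A2 t ** minvsqrt A1" for t
    by (simp add: geo matrix_mul_assoc matrix_mult_cancel_right TS ST flip: T_def)
  ultimately show ?thesis
    unfolding tr orth by blast
qed

end
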